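(* Consider the online case $f(x)=\frac1n\sum_{i=1}^n f_i(x)$, $f_i(x)=\mathbf{E}_{\xi_i\sim\mathcal{D}_i}[f_{\xi_i}(x)]$, $x\in\mathbb{R}^d$. Assume there exists $f_*\in\mathbb{R}$ with $f(x)\ge f_*$ for all $x\in\mathbb{R}^d$; that $f_i$ is $L_i$-smooth for all $i\in\{1,\dots,n\}$, i.e. $\|\nabla f_i(x)-\nabla f_i(y)\|\le L_i\|x-y\|$ for all $x,y\in\mathbb{R}^d$; that the average $\mathcal{L}$-smoothness assumption (see context) holds with constants $\mathcal{L}_i\ge0$; that $f$ satisfies the Polyak–Łojasiewicz condition with parameter $\mu$, i.e. $\|\nabla f(x)\|^2\ge2\mu(f(x)-f(x^* ))$ for all $x\in\mathbb{R}^d$, where $x^*=\arg\min_{x\in\mathbb{R}^d}f(x)$; and that for all $i$ there exists $\sigma_i\in[0,+\infty)$ such that for all $x\in\mathbb{R}^d$, $\mathbf{E}_{\xi_i\sim\mathcal{D}_i}[\nabla f_{\xi_i}(x)]=\nabla f_i(x)$ and $\mathbf{E}_{\xi_i\sim\mathcal{D}_i}[\|\nabla f_{\xi_i}(x)-\nabla f_i(x)\|^2]\le\sigma_i^2$. Let $\mathcal{Q}$ be a quantization operator with parameter $\omega$ and expected density $\zeta_{\mathcal Q}$, let $p\in(0,1]$, and let $$\gamma\le\min\left\{\frac{1}{L+\sqrt{\frac{2(1-p)}{pn}\left(\omega L^2+\frac{(1+\omega)\mathcal{L}^2}{b'}\right)}},\frac{p}{2\mu}\right\},$$ where $L^2=\frac1n\sum_{i=1}^nL_i^2$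 and $\mathcal{L}^2=\frac1n\sum_{i=1}^n\mathcal{L}_i^2$. Then after $K$ iterations of VR-MARINA (online case) we have $$\mathbf{E}\left[f(x^K)-f(x^* )\right]\le(1-\gamma\mu)^K\Delta_0+\frac{\sigma^2}{nb\mu},$$ where $\Delta_0=f(x^0)-f(x^* )$ and $\sigma^2=\frac1n\sum_{i=1}^n\sigma_i^2$. That is, after $$K=\mathcal{O}\left(\max\left\{\frac1p,\frac{L+\sqrt{\frac{1-p}{pn}\left(\omega L^2+\frac{(1+\omega)\mathcal{L}^2}{b'}\right)}}{\mu}\right\}\log\frac{\Delta_0}{\varepsilon}\right)$$ iterations with $b=\Theta\left(\frac{\sigma^2}{n\mu\varepsilon}\right)$ VR-MARINA produces such a point $x^K$ that $\mathbf{E}[f(x^K)-f(x^* )]\le\varepsilon$, and the expected total number of stochastic oracle calls per node equals $$b+K(pb+2(1-p)b')=\mathcal{O}\left(b+\max\left\{\frac1p,\frac{L+\sqrt{\frac{1-p}{pn}\left(\omega L^2+\frac{(1+\omega)\mathcal{L}^2}{b'}\right)}}{\mu}\right\}(pb+(1-p)b')\log\frac{\Delta_0}{\varepsilon}\right).$$ Moreover, under an assumption that the communication cost is proportional to the number of non-zero components of transmitted vectors from workers to the server, the expected total communication cost per worker equals $$d+K(pd+(1-p)\zeta_{\mathcal Q})=\mathcal{O}\left(d+\max\left\{\frac1p,\frac{L+\sqrt{\frac{1-p}{pn}\left(\omega L^2+\frac{(1+\omega)\mathcal{L}^2}{b'}\right)}}{\mu}\right\}(pd+(1-p)\zeta_{\mathcal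 Q})\log\frac{\Delta_0}{\varepsilon}\right).$$
   Context: $\|\cdot\|$ is the Euclidean norm; $\|y\|_0$ is the number of non-zero components of $y\in\mathbb{R}^d$. Quantization operator: a stochastic mapping $\mathcal{Q}:\mathbb{R}^d\to\mathbb{R}^d$ for which there is $\omega>0$ with $\mathbf{E}[\mathcal{Q}(x)]=x$ and $\mathbf{E}[\|\mathcal{Q}(x)-x\|^2]\le\omega\|x\|^2$ for any $x\in\mathbb{R}^d$. Its expected density is $\zeta_{\mathcal Q}=\sup_{x\in\mathbb{R}^d}\mathbf{E}[\|\mathcal{Q}(x)\|_0]$. VR-MARINA, online case (a distributed method with $n$ workers and a server; input: starting point $x^0$, stepsize $\gamma$, minibatch sizes $b$ and $b'<b$, probability $p\in(0,1]$, number of iterations $K$): initialize $g^0=\frac1{nb}\sum_{i=1}^n\sum_{j\in I_{i,0}}\nabla f_{\xi_{ij}^0}(x^0)$, where $I_{i,0}$ is the set of the indices in the minibatch, $|I_{i,0}|=b$. For $k=0,\dots,K-1$: sample $c_k\sim\mathrm{Bernoulli}(p)$ and broadcast $g^k$ to all workers; each worker $i=1,\dots,n$ in parallel computes $x^{k+1}=x^k-\gamma g^k$ and sets $g_i^{k+1}=\frac1b\sum_{j\in I_{i,k}}\nabla f_{\xi_{ij}^k}(x^{k+1})$ if $c_k=1$, and $g_i^{k+1}=g^k+\mathcal{Q}(\widetilde\Delta_i^k)$ if $c_k=0$, where $\widetilde\Delta_i^k=\frac1{b'}\sum_{j\in I'_{i,k}}(\nabla f_{\xi_{ij}^k}(x^{k+1})-\nabla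 f_{\xi_{ij}^k}(x^k))$ and $I_{i,k},I'_{i,k}$ are the sets of the indices in the minibatches, $|I_{i,k}|=b$, $|I'_{i,k}|=b'$; then $g^{k+1}=\frac1n\sum_{i=1}^n g_i^{k+1}$. Here the $\xi_{ij}^k$ are independently sampled from $\mathcal{D}_i$. The point considered here is the last iterate $x^K$. Average $\mathcal{L}$-smoothness: for all $k\ge0$ and $i\in\{1,\dots,n\}$, with $\Delta_i^k=\nabla f_i(x^{k+1})-\nabla f_i(x^k)$, one has $\mathbf{E}[\widetilde\Delta_i^k\mid x^k,x^{k+1}]=\Delta_i^k$ and $\mathbf{E}[\|\widetilde\Delta_i^k-\Delta_i^k\|^2\mid x^k,x^{k+1}]\le\frac{\mathcal{L}_i^2}{b'}\|x^{k+1}-x^k\|^2$ with some $\mathcal{L}_i\ge0$. A stochastic oracle call is the computation of one stochastic gradient $\nabla f_{\xi}$ at one point.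
   Formalization: Communication cost: equality holds when uncompressed vectors cost d and quantized ones their expected density; for actual non-zero components it is an upper bound. Complexity claims take γ equal to its bound, b at least 2σ²/(nμε), and read the log as max(1, log(Δ0/ε)). *)

theory Defs
  imports "HOL-Probability.Probability"
begin

definition grad :: "(real^'d \<Rightarrow> real) \<Rightarrow> real^'d \<Rightarrow> real^'d" where
  "grad f x = (THE g. GDERIV f x :> g)"

definition nnz :: "real^'d \<Rightarrow> nat" where
  "nnz y = card {j. y $ j \<noteq> 0}"

text \<open>A stochastic mapping is represented by a deterministic map \<open>Q s x\<close> with a random seed
  \<open>s\<close> drawn from \<open>QM\<close>. Finiteness of the moments is stated explicitly, because the Bochner
  integral of a non-integrable function is 0.\<close>

definition quantization ::
  "'q measure \<Rightarrow> ('q \<Rightarrow> real^'d \<Rightarrow> real^'d) \<Rightarrow> real \<Rightarrow> bool" where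
  "quantization QM Q \<omega> \<longleftrightarrow>
     prob_space QM \<and> \<omega> > 0 \<and>
     (\<lambda>(s, x). Q s x) \<in> borel_measurable (QM \<Otimes>\<^sub>M borel) \<and>
     (\<forall>x. integrable QM (\<lambda>s. Q s x) \<and> (\<integral>s. Q s x \<partial>QM) = x \<and>
          integrable QM (\<lambda>s. (norm (Q s x - x))\<^sup>2) \<and>
          (\<integral>s. (norm (Q s x - x))\<^sup>2 \<partial>QM) \<le> \<omega> * (norm x)\<^sup>2)"

definition expected_density :: "'q measure \<Rightarrow> ('q \<Rightarrow> real^'d \<Rightarrow> real^'d) \<Rightarrow> real" where
  "expected_density QM Q = (SUP x. \<integral>s. real (nnz (Q s x)) \<partial>QM)"

definition smooth_with :: "real \<Rightarrow> (real^'d \<Rightarrow> real) \<Rightarrow> bool" where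
  "smooth_with Lc f \<longleftrightarrow>
     (\<forall>x. f differentiable (at x)) \<and>
     (\<forall>x y. norm (grad f x - grad f y) \<le> Lc * norm (x - y))"

definition polyak_lojasiewicz :: "real \<Rightarrow> (real^'d \<Rightarrow> real) \<Rightarrow> real^'d \<Rightarrow> bool" where
  "polyak_lojasiewicz \<mu> f xstar \<longleftrightarrow>
     is_arg_min f (\<lambda>_. True) xstar \<and>
     (\<forall>x. (norm (grad f x))\<^sup>2 \<ge> 2 * \<mu> * (f x - f xstar))"

definition local_loss :: "(nat \<Rightarrow> 'xi measure) \<Rightarrow> ('xi \<Rightarrow> real^'d \<Rightarrow> real) \<Rightarrow> nat \<Rightarrow> real^'d \<Rightarrow> real" where
  "local_loss D F i x = (\<integral>\<xi>. F \<xi> x \<partial>(D i))"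

definition global_loss :: "(nat \<Rightarrow> 'xi measure) \<Rightarrow> ('xi \<Rightarrow> real^'d \<Rightarrow> real) \<Rightarrow> nat \<Rightarrow> real^'d \<Rightarrow> real" where
  "global_loss D F n x = (1 / real n) * (\<Sum>i=1..n. local_loss D F i x)"

text \<open>Well-posedness of \<open>f\<^sub>i(x) = E f\<^sub>\<xi>(x)\<close> and of the stochastic gradients.\<close>

definition stochastic_losses :: "(nat \<Rightarrow> 'xi measure) \<Rightarrow> ('xi \<Rightarrow> real^'d \<Rightarrow> real) \<Rightarrow> nat \<Rightarrow> bool" where
  "stochastic_losses D F n \<longleftrightarrow>
     (\<forall>i\<in>{1..n}. prob_space (D i) \<and>
        (\<forall>x. integrable (D i) (\<lambda>\<xi>. F \<xi> x)) \<and>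
        (\<forall>\<xi>\<in>space (D i). \<forall>x. F \<xi> differentiable (at x)) \<and>
        (\<lambda>(\<xi>, x). grad (F \<xi>) x) \<in> borel_measurable (D i \<Otimes>\<^sub>M borel))"

definition bounded_variance ::
  "'xi measure \<Rightarrow> ('xi \<Rightarrow> real^'d \<Rightarrow> real) \<Rightarrow> (real^'d \<Rightarrow> real) \<Rightarrow> real \<Rightarrow> bool" where
  "bounded_variance Di F fi \<sigma>i \<longleftrightarrow>
     \<sigma>i \<ge> 0 \<and>
     (\<forall>x. integrable Di (\<lambda>\<xi>. grad (F \<xi>) x) \<and>
          (\<integral>\<xi>. grad (F \<xi>) x \<partial>Di) = grad fi x \<and>
          integrable Di (\<lambda>\<xi>. (norm (grad (F \<xi>) x - grad fi x))\<^sup>2) \<and>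
          (\<integral>\<xi>. (norm (grad (F \<xi>) x - grad fi x))\<^sup>2 \<partial>Di) \<le> \<sigma>i\<^sup>2)"

text \<open>The sources of randomness: \<open>xi t i j\<close> is the \<open>j\<close>-th data sample of worker \<open>i\<close> in round \<open>t\<close>,
  where round \<open>0\<close> is the initialization and round \<open>k + 1\<close> is iteration \<open>k\<close> (so every iteration,
  including the one with \<open>k = 0\<close>, draws fresh samples); \<open>c k\<close> is the coin of iteration \<open>k\<close>;
  \<open>s k i\<close> is the seed of the quantization performed by worker \<open>i\<close> in iteration \<open>k\<close>.
  They take values in different types, so their mutual independence is stated for the families
  of events they generate.\<close>

datatype source = Sample nat nat nat | Coin nat | Seed nat nat

definition source_events ::
  "'w measure \<Rightarrow> (nat \<Rightarrow> 'xi measure) \<Rightarrow> 'q measure \<Rightarrow> (nat \<Rightarrow> nat \<Rightarrow> nat \<Rightarrow> 'w \<Rightarrow> 'xi) \<Rightarrow>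
   (nat \<Rightarrow> 'w \<Rightarrow> bool) \<Rightarrow> (nat \<Rightarrow> nat \<Rightarrow> 'w \<Rightarrow> 'q) \<Rightarrow> source \<Rightarrow> 'w set set" where
  "source_events M D QM xi c s src =
     (case src of
        Sample t i j \<Rightarrow> {xi t i j -` A \<inter> space M | A. A \<in> sets (D i)}
      | Coin k \<Rightarrow> {c k -` A \<inter> space M | A. True}
      | Seed k i \<Rightarrow> {s k i -` A \<inter> space M | A. A \<in> sets QM})"

definition independent_sources ::
  "'w measure \<Rightarrow> (nat \<Rightarrow> 'xi measure) \<Rightarrow> 'q measure \<Rightarrow> real \<Rightarrow> nat \<Rightarrow>
   (nat \<Rightarrow> nat \<Rightarrow> nat \<Rightarrow> 'w \<Rightarrow> 'xi) \<Rightarrow> (nat \<Rightarrow> 'w \<Rightarrow> bool) \<Rightarrow> (nat \<Rightarrow> nat \<Rightarrow> 'w \<Rightarrow> 'q) \<Rightarrow> bool" where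
  "independent_sources M D QM p n xi c s \<longleftrightarrow>
     (\<forall>t j. \<forall>i\<in>{1..n}. xi t i j \<in> measurable M (D i) \<and> distr M (D i) (xi t i j) = D i) \<and>
     (\<forall>k. c k \<in> measurable M (count_space UNIV) \<and>
          distr M (count_space UNIV) (c k) = measure_pmf (bernoulli_pmf p)) \<and>
     (\<forall>k. \<forall>i\<in>{1..n}. s k i \<in> measurable M QM \<and> distr M QM (s k i) = QM) \<and>
     prob_space.indep_sets M (source_events M D QM xi c s)
       ({Sample t i j | t i j. i \<in> {1..n}} \<union> range Coin \<union> {Seed k i | k i. i \<in> {1..n}})"

text \<open>\<open>x\<close>, \<open>g\<close> are the iterates and gradient estimators, \<open>gw k i\<close> is \<open>g\<^sub>i\<^sup>k\<close>, and \<open>Dt k i\<close> is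
  \<open>\<Delta>\<close>-tilde. The minibatches \<open>I i t\<close>, \<open>I' i t\<close> carry the same round index as the samples.\<close>

definition vr_marina_online ::
  "('xi \<Rightarrow> real^'d \<Rightarrow> real) \<Rightarrow> ('q \<Rightarrow> real^'d \<Rightarrow> real^'d) \<Rightarrow> nat \<Rightarrow> nat \<Rightarrow> nat \<Rightarrow> real \<Rightarrow> real^'d \<Rightarrow>
   (nat \<Rightarrow> nat \<Rightarrow> nat set) \<Rightarrow> (nat \<Rightarrow> nat \<Rightarrow> nat set) \<Rightarrow>
   (nat \<Rightarrow> nat \<Rightarrow> nat \<Rightarrow> 'w \<Rightarrow> 'xi) \<Rightarrow> (nat \<Rightarrow> 'w \<Rightarrow> bool) \<Rightarrow> (nat \<Rightarrow> nat \<Rightarrow> 'w \<Rightarrow> 'q) \<Rightarrow>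
   (nat \<Rightarrow> 'w \<Rightarrow> real^'d) \<Rightarrow> (nat \<Rightarrow> 'w \<Rightarrow> real^'d) \<Rightarrow>
   (nat \<Rightarrow> nat \<Rightarrow> 'w \<Rightarrow> real^'d) \<Rightarrow> (nat \<Rightarrow> nat \<Rightarrow> 'w \<Rightarrow> real^'d) \<Rightarrow> bool" where
  "vr_marina_online F Q n b b' \<gamma> x0 I I' xi c s x g gw Dt \<longleftrightarrow>
     (\<forall>w. x 0 w = x0 \<and>
          (\<forall>i. gw 0 i w = (1 / real b) *\<^sub>R (\<Sum>j\<in>I i 0. grad (F (xi 0 i j w)) x0)) \<and>
          g 0 w = (1 / (real n * real b)) *\<^sub>R (\<Sum>i=1..n. \<Sum>j\<in>I i 0. grad (F (xi 0 i j w)) x0)) \<and>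
     (\<forall>k w. x (Suc k) w = x k w - \<gamma> *\<^sub>R g k w \<and>
          (\<forall>i. Dt k i w = (1 / real b') *\<^sub>R (\<Sum>j\<in>I' i (Suc k).
                 grad (F (xi (Suc k) i j w)) (x (Suc k) w) - grad (F (xi (Suc k) i j w)) (x k w))) \<and>
          (\<forall>i. gw (Suc k) i w =
                 (if c k w
                  then (1 / real b) *\<^sub>R (\<Sum>j\<in>I i (Suc k). grad (F (xi (Suc k) i j w)) (x (Suc k) w))
                  else g k w + Q (s k i w) (Dt k i w))) \<and>
          g (Suc k) w = (1 / real n) *\<^sub>R (\<Sum>i=1..n. gw (Suc k) i w))"

text \<open>Average smoothness for one worker, along the trajectory. The conditional expectation of the
  vector is taken componentwise; the one of the squared norm is the nonnegative extended version,
  which needs no integrability.\<close>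

definition step_algebra :: "'w measure \<Rightarrow> (nat \<Rightarrow> 'w \<Rightarrow> real^'d) \<Rightarrow> nat \<Rightarrow> 'w measure" where
  "step_algebra M x k = vimage_algebra (space M) (\<lambda>w. (x k w, x (Suc k) w)) borel"

definition average_smooth ::
  "'w measure \<Rightarrow> (nat \<Rightarrow> 'w \<Rightarrow> real^'d) \<Rightarrow> (real^'d \<Rightarrow> real) \<Rightarrow> (nat \<Rightarrow> 'w \<Rightarrow> real^'d) \<Rightarrow>
   nat \<Rightarrow> real \<Rightarrow> bool" where
  "average_smooth M x fi Dti b' \<L>i \<longleftrightarrow>
     \<L>i \<ge> 0 \<and>
     (\<forall>k j. AE w in M. real_cond_exp M (step_algebra M x k) (\<lambda>v. Dti k v $ j) w
                = (grad fi (x (Suc k) w) - grad fi (x k w)) $ j) \<and>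
     (\<forall>k. AE w in M.
        nn_cond_exp M (step_algebra M x k)
          (\<lambda>v. ennreal ((norm (Dti k v - (grad fi (x (Suc k) v) - grad fi (x k v))))\<^sup>2)) w
        \<le> ennreal (\<L>i\<^sup>2 / real b' * (norm (x (Suc k) w - x k w))\<^sup>2))"

text \<open>Oracle calls of worker \<open>i\<close> in the initialization and the first \<open>K\<close> iterations.\<close>

definition oracle_calls ::
  "(nat \<Rightarrow> nat \<Rightarrow> nat set) \<Rightarrow> (nat \<Rightarrow> nat \<Rightarrow> nat set) \<Rightarrow> (nat \<Rightarrow> 'w \<Rightarrow> bool) \<Rightarrow> nat \<Rightarrow> nat \<Rightarrow> 'w \<Rightarrow> nat" where
  "oracle_calls I I' c i K w =
     card (I i 0) + (\<Sum>k<K. if c k w then card (I i (Suc k)) else 2 * card (I' i (Suc k)))"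

text \<open>Non-zero components actually sent by worker \<open>i\<close>: it sends \<open>g\<^sub>i\<close> in the initialization and when
  the coin is 1, and only the quantized difference otherwise (the server knows \<open>g k\<close>).\<close>

definition sent_components ::
  "('q \<Rightarrow> real^'d \<Rightarrow> real^'d) \<Rightarrow> (nat \<Rightarrow> 'w \<Rightarrow> bool) \<Rightarrow> (nat \<Rightarrow> nat \<Rightarrow> 'w \<Rightarrow> 'q) \<Rightarrow>
   (nat \<Rightarrow> nat \<Rightarrow> 'w \<Rightarrow> real^'d) \<Rightarrow> (nat \<Rightarrow> nat \<Rightarrow> 'w \<Rightarrow> real^'d) \<Rightarrow> nat \<Rightarrow> nat \<Rightarrow> 'w \<Rightarrow> nat" where
  "sent_components Q c s gw Dt i K w =
     nnz (gw 0 i w) +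
     (\<Sum>k<K. if c k w then nnz (gw (Suc k) i w) else nnz (Q (s k i w) (Dt k i w)))"

text \<open>The same messages under the customary accounting: \<open>d\<close> for an uncompressed vector (which is
  dense in general) and the expected density \<open>\<zeta>\<close> for a quantized one. The number of non-zero
  components actually sent is in general smaller in expectation, because the expected density is
  a supremum over all inputs.\<close>

definition communication_cost :: "real \<Rightarrow> real \<Rightarrow> (nat \<Rightarrow> 'w \<Rightarrow> bool) \<Rightarrow> nat \<Rightarrow> 'w \<Rightarrow> real" where
  "communication_cost d \<zeta> c K w = d + (\<Sum>k<K. if c k w then d else \<zeta>)"

end

theory Submission
  imports Defs
begin

text \<open>Let \<open>G k\<close> be the expected squared error of the gradient estimator \<open>g k\<close> and \<open>r k\<close> the expected
  squared length of the step \<open>x (Suc k) - x k\<close>. Freezing the independent sources of randomness one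
  at a time, all cross terms between the noises of different samples, of different quantizations and
  of the past vanish. Hence a coin 1 resets the error to at most \<open>\<sigma>\<^sup>2 / (n b)\<close>, while a coin 0 only
  adds to \<open>G k\<close> a multiple of \<open>r k\<close>. The descent inequality for smooth functions provides a negative
  multiple of \<open>r k\<close> which, for the given stepsizes, absorbs that term; with the
  Polyak-Lojasiewicz inequality, the expectation of \<open>f (x k) - f xstar\<close> plus \<open>\<gamma> / p * G k\<close> then
  contracts by the factor \<open>1 - \<gamma> \<mu>\<close> up to the additive term \<open>\<gamma> \<sigma>\<^sup>2 / (n b)\<close>. As \<open>\<gamma> / p\<close> is at most
  \<open>1 / (2 \<mu>)\<close>, the initial error is covered by the limit \<open>\<sigma>\<^sup>2 / (n b \<mu>)\<close> of the geometric series.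
  Average smoothness enters only through its total expectation; the unbiasedness of the stochastic
  gradient differences follows from that of the stochastic gradients.\<close>

section \<open>Gradients of smooth functions\<close>

lemma grad_eqI:
  assumes "GDERIV f x :> g"
  shows "grad f x = g"
proof -
  have "g' = g" if "GDERIV f x :> g'" for g'
  proof -
    have "(\<lambda>h. inner h g') = (\<lambda>h. inner h g)"
      using assms that unfolding gderiv_def by (rule has_derivative_unique[rotated])
    then show ?thesis
      by (metis vector_eq_ldot)
  qed
  then show ?thesis
    unfolding grad_def using assms by blast
qed

lemma GDERIV_grad:
  fixes f :: "real^'d \<Rightarrow> real"
  assumes "f differentiable (at x)"
  shows "GDERIV f x :> grad f x"
proof -
  from assms obtain f' where f': "(f has_derivative f') (at x)"
    unfolding differentiable_def by blast
  interpret linear f'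
    using f' by (rule has_derivative_linear)
  \<comment> \<open>The Riesz representative of the derivative, assembled from its values on the
    orthonormal basis.\<close>
  define g where "g = (\<Sum>b\<in>Basis. f' b *\<^sub>R b)"
  have "f' h = inner h g" for h
  proof -
    have "f' h = f' (\<Sum>b\<in>Basis. inner h b *\<^sub>R b)"
      by (simp add: euclidean_representation)
    also have "\<dots> = (\<Sum>b\<in>Basis. inner h b * f' b)"
      by (simp add: sum scale)
    finally show ?thesis
      by (simp add: g_def inner_sum_right mult.commute)
  qed
  then have "GDERIV f x :> g"
    using f' unfolding gderiv_def by (metis ext)
  with grad_eqI show ?thesis
    by metis
qed

lemma smooth_with_continuous_grad:
  assumes "smooth_with C f"
  shows "continuous_on UNIV (grad f)"
proof -
  have "norm (grad f x - grad f y) \<le> C * norm (x - y)" for x y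
    using assms unfolding smooth_with_def by blast
  \<comment> \<open>\<open>lipschitz_on\<close> asks for a nonnegative constant, which
    \<open>smooth_with\<close> does not state; hence the absolute value.\<close>
  then have lip: "\<And>x y. dist (grad f x) (grad f y) \<le> \<bar>C\<bar> * dist x y"
    by (smt (verit) dist_norm mult_right_mono norm_ge_zero)
  then have "\<bar>C\<bar>-lipschitz_on UNIV (grad f)"
    by (intro lipschitz_onI) auto
  then show ?thesis
    by (rule lipschitz_on_continuous_on)
qed

lemma smooth_with_continuous:
  assumes "smooth_with C f"
  shows "continuous_on UNIV f"
  using assms unfolding smooth_with_def
  by (meson continuous_at_imp_continuous_on differentiable_imp_continuous_within)

text \<open>The excess of \<open>f\<close> over its quadratic model along the segment from
  \<open>x\<close> to \<open>y\<close> has a nonpositive derivative, by Cauchy-Schwarz and the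
  Lipschitz bound on the gradient.\<close>

lemma smooth_with_upper_bound:
  assumes "smooth_with C f"
  shows "f y \<le> f x + inner (grad f x) (y - x) + C / 2 * (norm (y - x))\<^sup>2"
proof -
  define v where "v = y - x"
  define \<phi> where "\<phi> t = f (x + t *\<^sub>R v) - t * inner (grad f x) v - C / 2 * t\<^sup>2 * (norm v)\<^sup>2" for t
  have deriv: "(\<phi> has_real_derivative
      inner (grad f (x + t *\<^sub>R v) - grad f x) v - C * t * (norm v)\<^sup>2) (at t)" for t
  proof -
    have "(f has_derivative (\<lambda>h. inner h (grad f (x + t *\<^sub>R v)))) (at (x + t *\<^sub>R v))"
      using assms GDERIV_grad unfolding smooth_with_def gderiv_def by blast
    moreover have "((\<lambda>t. x + t *\<^sub>R v) has_derivative (\<lambda>h. h *\<^sub>R v)) (at t)"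
      by (auto intro!: derivative_eq_intros)
    ultimately have "((\<lambda>t. f (x + t *\<^sub>R v)) has_derivative
        (\<lambda>h. inner (h *\<^sub>R v) (grad f (x + t *\<^sub>R v)))) (at t)"
      using has_derivative_compose by blast
    then have "((\<lambda>t. f (x + t *\<^sub>R v)) has_real_derivative inner (grad f (x + t *\<^sub>R v)) v) (at t)"
      unfolding has_field_derivative_def by (simp add: inner_commute mult.commute[of _ "inner _ _"])
    then show ?thesis
      unfolding \<phi>_def
      by (auto intro!: derivative_eq_intros simp: inner_diff_left power2_eq_square algebra_simps)
  qed
  have "\<phi> 1 \<le> \<phi> 0"
  proof (rule DERIV_nonpos_imp_nonincreasing[where f = \<phi> and a = 0 and b = 1])
    fix t :: real assume t: "0 \<le> t" "t \<le> 1"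
    have "inner (grad f (x + t *\<^sub>R v) - grad f x) v
        \<le> norm (grad f (x + t *\<^sub>R v) - grad f x) * norm v"
      by (rule norm_cauchy_schwarz)
    also have "\<dots> \<le> (C * norm (t *\<^sub>R v)) * norm v"
    proof (rule mult_right_mono)
      have "norm (grad f (x + t *\<^sub>R v) - grad f x) \<le> C * norm (x + t *\<^sub>R v - x)"
        using assms unfolding smooth_with_def by blast
      then show "norm (grad f (x + t *\<^sub>R v) - grad f x) \<le> C * norm (t *\<^sub>R v)"
        by simp
    qed simp
    also have "\<dots> = C * t * (norm v)\<^sup>2"
      using t by (simp add: power2_eq_square)
    finally show "\<exists>y. (\<phi> has_real_derivative y) (at t) \<and> y \<le> 0"
      using deriv by (intro exI conjI) auto
  qed simp
  then show ?thesis
    by (simp add: \<phi>_def v_def)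
qed

lemma norm_add_sq:
  fixes u v :: "'a::real_inner"
  shows "(norm (u + v))\<^sup>2 = (norm u)\<^sup>2 + 2 * inner u v + (norm v)\<^sup>2"
  by (simp add: power2_norm_eq_inner inner_simps inner_commute)

text \<open>Provides an integrable dominating function for inner products of square-integrable
  vectors, for which the constant does not matter.\<close>

lemma abs_inner_le_norm_sq:
  fixes u v :: "'a::real_inner"
  shows "\<bar>inner u v\<bar> \<le> (norm u)\<^sup>2 + (norm v)\<^sup>2"
proof -
  have "0 \<le> (norm (u + v))\<^sup>2" "0 \<le> (norm (u - v))\<^sup>2"
    by simp_all
  then show ?thesis
    unfolding norm_add_sq diff_conv_add_uminus norm_minus_cancel inner_minus_right
    using zero_le_power2[of "norm u"] zero_le_power2[of "norm v"] by linarith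
qed

text \<open>Polarization turns \<open>inner (grad f x) g\<close> into squares, among them the
  squared error of \<open>g\<close>. The square of \<open>g\<close> itself is rewritten as a
  negative multiple of the squared step, kept to absorb the growth of the error later.\<close>

lemma smooth_step_descent:
  assumes smooth: "smooth_with C f" and \<gamma>: "\<gamma> > 0" and y: "y = x - \<gamma> *\<^sub>R g"
  shows "f y \<le> f x - \<gamma> / 2 * (norm (grad f x))\<^sup>2 - (1 / (2 * \<gamma>) - C / 2) * (norm (y - x))\<^sup>2
               + \<gamma> / 2 * (norm (g - grad f x))\<^sup>2"
proof -
  have yx: "y - x = - \<gamma> *\<^sub>R g"
    using y by simp
  have nrm: "(norm (y - x))\<^sup>2 = \<gamma>\<^sup>2 * (norm g)\<^sup>2"
    unfolding yx using \<gamma> by (simp add: power_mult_distrib)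
  have "(norm (g - grad f x))\<^sup>2 = (norm g)\<^sup>2 - 2 * inner (grad f x) g + (norm (grad f x))\<^sup>2"
    using norm_add_sq[of g "- grad f x"] by (simp add: inner_commute)
  then have ig: "inner (grad f x) g = ((norm g)\<^sup>2 + (norm (grad f x))\<^sup>2 - (norm (g - grad f x))\<^sup>2) / 2"
    by simp
  have "inner (grad f x) (y - x)
      = \<gamma> / 2 * (norm (g - grad f x))\<^sup>2 - \<gamma> / 2 * (norm (grad f x))\<^sup>2 - \<gamma> / 2 * (norm g)\<^sup>2"
    unfolding yx inner_scaleR_right ig by (simp add: field_simps)
  moreover have "1 / (2 * \<gamma>) * (norm (y - x))\<^sup>2 = \<gamma> / 2 * (norm g)\<^sup>2"
    unfolding nrm using \<gamma> by (simp add: power2_eq_square)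
  ultimately show ?thesis
    using smooth_with_upper_bound[OF smooth, of y x] by (simp add: algebra_simps)
qed

section \<open>Averages of smooth functions\<close>

lemma GDERIV_sum:
  assumes "\<And>i. i \<in> A \<Longrightarrow> GDERIV (f i) x :> g i"
  shows "GDERIV (\<lambda>y. \<Sum>i\<in>A. f i y) x :> (\<Sum>i\<in>A. g i)"
  using assms unfolding gderiv_def inner_sum_right by (auto intro: has_derivative_sum)

lemma GDERIV_average:
  assumes "\<And>i. i \<in> {1..n} \<Longrightarrow> GDERIV (f i) x :> g i"
  shows "GDERIV (\<lambda>y. (1 / real n) * (\<Sum>i=1..n. f i y)) x :> (1 / real n) *\<^sub>R (\<Sum>i=1..n. g i)"
  using GDERIV_sum[OF assms] unfolding gderiv_def inner_scaleR_right
  by (rule has_derivative_mult_right)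

lemma sum_sq_le_card_sum_sq:
  fixes a :: "nat \<Rightarrow> real"
  shows "(\<Sum>i=1..n. a i)\<^sup>2 \<le> real n * (\<Sum>i=1..n. (a i)\<^sup>2)"
  using Cauchy_Schwarz_ineq_sum[of "\<lambda>_. 1" a "{1..n}"] by simp

text \<open>The triangle inequality yields the arithmetic mean of the \<open>C i\<close> as
  Lipschitz constant; Cauchy-Schwarz relaxes it to their quadratic mean.\<close>

lemma smooth_with_average:
  fixes f :: "nat \<Rightarrow> real^'d \<Rightarrow> real"
  assumes n: "n \<ge> 1" and smooth: "\<And>i. i \<in> {1..n} \<Longrightarrow> smooth_with (C i) (f i)"
  shows "smooth_with (sqrt ((1 / real n) * (\<Sum>i=1..n. (C i)\<^sup>2))) (\<lambda>x. (1 / real n) * (\<Sum>i=1..n. f i x))"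
    and "grad (\<lambda>x. (1 / real n) * (\<Sum>i=1..n. f i x)) x = (1 / real n) *\<^sub>R (\<Sum>i=1..n. grad (f i) x)"
proof -
  let ?f = "\<lambda>x. (1 / real n) * (\<Sum>i=1..n. f i x)"
  have G: "GDERIV ?f x :> (1 / real n) *\<^sub>R (\<Sum>i=1..n. grad (f i) x)" for x
    using smooth by (intro GDERIV_average GDERIV_grad) (auto simp: smooth_with_def)
  then have grad: "grad ?f x = (1 / real n) *\<^sub>R (\<Sum>i=1..n. grad (f i) x)" for x
    by (rule grad_eqI)
  then show "grad ?f x = (1 / real n) *\<^sub>R (\<Sum>i=1..n. grad (f i) x)" .
  have "norm (grad ?f x - grad ?f y)
      \<le> sqrt ((1 / real n) * (\<Sum>i=1..n. (C i)\<^sup>2)) * norm (x - y)" for x y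
  proof -
    have "norm (grad ?f x - grad ?f y)
        = (1 / real n) * norm (\<Sum>i=1..n. grad (f i) x - grad (f i) y)"
      unfolding grad sum_subtractf scaleR_diff_right[symmetric] by simp
    also have "\<dots> \<le> (1 / real n) * (\<Sum>i=1..n. C i * norm (x - y))"
      using smooth unfolding smooth_with_def
      by (intro mult_left_mono order_trans[OF norm_sum] sum_mono) auto
    also have "\<dots> = (1 / real n) * (\<Sum>i=1..n. C i) * norm (x - y)"
      by (simp add: sum_distrib_right)
    also have "\<dots> \<le> sqrt ((1 / real n) * (\<Sum>i=1..n. (C i)\<^sup>2)) * norm (x - y)"
    proof (intro mult_right_mono real_le_rsqrt)
      have "((1 / real n) * (\<Sum>i=1..n. C i))\<^sup>2 = (1 / real n)\<^sup>2 * (\<Sum>i=1..n. C i)\<^sup>2"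
        by (rule power_mult_distrib)
      also have "\<dots> \<le> (1 / real n)\<^sup>2 * (real n * (\<Sum>i=1..n. (C i)\<^sup>2))"
        by (intro mult_left_mono sum_sq_le_card_sum_sq) auto
      also have "\<dots> = (1 / real n) * (\<Sum>i=1..n. (C i)\<^sup>2)"
        using n by (simp add: power2_eq_square)
      finally show "((1 / real n) * (\<Sum>i=1..n. C i))\<^sup>2 \<le> (1 / real n) * (\<Sum>i=1..n. (C i)\<^sup>2)" .
    qed simp
    finally show ?thesis .
  qed
  moreover have "?f differentiable (at x)" for x
    using G[of x] unfolding gderiv_def differentiable_def by blast
  ultimately show "smooth_with (sqrt ((1 / real n) * (\<Sum>i=1..n. (C i)\<^sup>2))) ?f"
    unfolding smooth_with_def by blast
qed

section \<open>Square-integrable random vectors\<close>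

text \<open>Membership in L2. Measurability of \<open>V\<close> is required separately, as it does
  not follow from that of the squared norm.\<close>

definition sq_integrable :: "'w measure \<Rightarrow> ('w \<Rightarrow> 'e::euclidean_space) \<Rightarrow> bool" where
  "sq_integrable M V \<longleftrightarrow> V \<in> borel_measurable M \<and> integrable M (\<lambda>w. (norm (V w))\<^sup>2)"

lemma sq_integrable_inner:
  assumes "sq_integrable M U" "sq_integrable M V"
  shows "integrable M (\<lambda>w. inner (U w) (V w))"
proof (rule Bochner_Integration.integrable_bound)
  show "integrable M (\<lambda>w. (norm (U w))\<^sup>2 + (norm (V w))\<^sup>2)"
    using assms unfolding sq_integrable_def by auto
  show "(\<lambda>w. inner (U w) (V w)) \<in> borel_measurable M"
    using assms unfolding sq_integrable_def by auto
  show "AE w in M. norm (inner (U w) (V w)) \<le> norm ((norm (U w))\<^sup>2 + (norm (V w))\<^sup>2)"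
    using abs_inner_le_norm_sq by (intro AE_I2) (auto intro: order_trans[OF _ abs_ge_self])
qed

lemma sq_integrable_add:
  assumes "sq_integrable M U" "sq_integrable M V"
  shows "sq_integrable M (\<lambda>w. U w + V w)"
  using assms sq_integrable_inner[OF assms] unfolding sq_integrable_def norm_add_sq by auto

lemma sq_integrable_scaleR:
  assumes "sq_integrable M U"
  shows "sq_integrable M (\<lambda>w. a *\<^sub>R U w)"
  using assms unfolding sq_integrable_def by (auto simp: power_mult_distrib)

lemma sq_integrable_diff:
  assumes "sq_integrable M U" "sq_integrable M V"
  shows "sq_integrable M (\<lambda>w. U w - V w)"
  using sq_integrable_add[OF assms(1) sq_integrable_scaleR[OF assms(2), of "-1"]] by simp

lemma (in finite_measure) sq_integrable_const: "sq_integrable M (\<lambda>_. v)"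
  unfolding sq_integrable_def by auto

lemma (in finite_measure) sq_integrable_sum:
  assumes "\<And>i. i \<in> A \<Longrightarrow> sq_integrable M (U i)"
  shows "sq_integrable M (\<lambda>w. \<Sum>i\<in>A. U i w)"
  using assms
  by (induction A rule: infinite_finite_induct) (auto intro: sq_integrable_add sq_integrable_const)

lemma sq_integrable_bound:
  assumes "sq_integrable M U" "V \<in> borel_measurable M" "\<And>w. norm (V w) \<le> C * norm (U w)"
  shows "sq_integrable M V"
  unfolding sq_integrable_def
proof
  show "integrable M (\<lambda>w. (norm (V w))\<^sup>2)"
  proof (rule Bochner_Integration.integrable_bound)
    show "integrable M (\<lambda>w. C\<^sup>2 * (norm (U w))\<^sup>2)"
      using assms unfolding sq_integrable_def by auto
    show "AE w in M. norm ((norm (V w))\<^sup>2) \<le> norm (C\<^sup>2 * (norm (U w))\<^sup>2)"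
      using assms(3) by (auto simp flip: power_mult_distrib intro!: power_mono)
  qed (use assms in auto)
qed (use assms in simp)

lemma sq_integrable_If:
  assumes "sq_integrable M U" "sq_integrable M V" "{w \<in> space M. P w} \<in> sets M"
  shows "sq_integrable M (\<lambda>w. if P w then U w else V w)"
  unfolding sq_integrable_def
proof
  show meas: "(\<lambda>w. if P w then U w else V w) \<in> borel_measurable M"
    using assms unfolding sq_integrable_def by (intro measurable_If) auto
  show "integrable M (\<lambda>w. (norm (if P w then U w else V w))\<^sup>2)"
  proof (rule Bochner_Integration.integrable_bound)
    show "integrable M (\<lambda>w. (norm (U w))\<^sup>2 + (norm (V w))\<^sup>2)"
      using assms unfolding sq_integrable_def by auto
  qed (use meas in auto)
qed

text \<open>Second moments are first bounded as nonnegative integrals, which presuppose no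
  integrability; a finite bound then carries over to the Bochner integral.\<close>

lemma sq_integrableI_nn_integral:
  assumes "V \<in> borel_measurable M" "C \<ge> 0" "(\<integral>\<^sup>+w. ennreal ((norm (V w))\<^sup>2) \<partial>M) \<le> ennreal C"
  shows "sq_integrable M V" "(\<integral>w. (norm (V w))\<^sup>2 \<partial>M) \<le> C"
proof -
  have "(\<integral>\<^sup>+w. ennreal ((norm (V w))\<^sup>2) \<partial>M) < \<infinity>"
    using assms(3) by (simp add: le_less_trans)
  then have int: "integrable M (\<lambda>w. (norm (V w))\<^sup>2)"
    using assms(1) by (intro integrableI_bounded) auto
  then show "sq_integrable M V"
    using assms(1) unfolding sq_integrable_def by simp
  show "(\<integral>w. (norm (V w))\<^sup>2 \<partial>M) \<le> C"
    using assms(2,3) nn_integral_eq_integral[OF int] by simp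
qed

text \<open>Orthogonality in L2. With square-integrability included, the vanishing integral cannot
  be the default value of a non-integrable function.\<close>

definition orthogonal_vars :: "'w measure \<Rightarrow> ('w \<Rightarrow> 'e::euclidean_space) \<Rightarrow> ('w \<Rightarrow> 'e) \<Rightarrow> bool" where
  "orthogonal_vars M U V \<longleftrightarrow>
     sq_integrable M U \<and> sq_integrable M V \<and> (\<integral>w. inner (U w) (V w) \<partial>M) = 0"

lemma orthogonal_vars_add:
  assumes "orthogonal_vars M U V" "orthogonal_vars M U W"
  shows "orthogonal_vars M U (\<lambda>w. V w + W w)"
  using assms unfolding orthogonal_vars_def
  by (auto simp: inner_add_right sq_integrable_inner intro: sq_integrable_add)

lemma orthogonal_vars_scaleR:
  assumes "orthogonal_vars M U V"
  shows "orthogonal_vars M U (\<lambda>w. a *\<^sub>R V w)"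
  using assms unfolding orthogonal_vars_def by (auto intro: sq_integrable_scaleR)

lemma (in finite_measure) orthogonal_vars_sum:
  assumes "sq_integrable M U" "\<And>i. i \<in> A \<Longrightarrow> orthogonal_vars M U (V i)"
  shows "orthogonal_vars M U (\<lambda>w. \<Sum>i\<in>A. V i w)"
  using assms(2)
proof (induction A rule: infinite_finite_induct)
  case (insert i A)
  then show ?case
    by (simp add: orthogonal_vars_add)
qed (auto simp: orthogonal_vars_def assms(1) sq_integrable_const)

lemma orthogonal_vars_norm_sq:
  assumes "orthogonal_vars M U V"
  shows "(\<integral>w. (norm (U w + V w))\<^sup>2 \<partial>M) = (\<integral>w. (norm (U w))\<^sup>2 \<partial>M) + (\<integral>w. (norm (V w))\<^sup>2 \<partial>M)"
  using assms unfolding orthogonal_vars_def norm_add_sq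
  by (simp add: sq_integrable_inner sq_integrable_def)

lemma (in finite_measure) orthogonal_vars_sum_norm_sq:
  assumes "finite A" "\<And>i. i \<in> A \<Longrightarrow> sq_integrable M (V i)"
    and "\<And>i j. i \<in> A \<Longrightarrow> j \<in> A \<Longrightarrow> i \<noteq> j \<Longrightarrow> orthogonal_vars M (V i) (V j)"
  shows "(\<integral>w. (norm (\<Sum>i\<in>A. V i w))\<^sup>2 \<partial>M) = (\<Sum>i\<in>A. \<integral>w. (norm (V i w))\<^sup>2 \<partial>M)"
  using assms
proof (induction A rule: finite_induct)
  case (insert i A)
  have "orthogonal_vars M (V i) (\<lambda>w. \<Sum>j\<in>A. V j w)"
    using insert by (intro orthogonal_vars_sum) auto
  with insert show ?case
    by (simp add: orthogonal_vars_norm_sq)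
qed simp

section \<open>Freezing an independent variable\<close>

lemma Int_stable_vimage: "Int_stable {Y -` A \<inter> \<Omega> | A. A \<in> sets N}"
proof (rule Int_stableI, safe)
  fix A B assume "A \<in> sets N" "B \<in> sets N"
  then show "\<exists>C. Y -` A \<inter> \<Omega> \<inter> (Y -` B \<inter> \<Omega>) = Y -` C \<inter> \<Omega> \<and> C \<in> sets N"
    by (intro exI[of _ "A \<inter> B"]) auto
qed

context prob_space
begin

text \<open>Both measures agree on rectangles. Independence is assumed from a whole
  sub-sigma-algebra \<open>A\<close>, so that every \<open>A\<close>-measurable \<open>X\<close>,
  with values in any space, can later be frozen.\<close>

lemma distr_pair_independent:
  assumes A: "subalgebra M A"
    and ind: "indep_set (sets A) {Y -` C \<inter> space M | C. C \<in> sets N'}"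
    and X: "X \<in> measurable A N" and Y: "Y \<in> measurable M N'"
  shows "distr M N X \<Otimes>\<^sub>M distr M N' Y = distr M (N \<Otimes>\<^sub>M N') (\<lambda>w. (X w, Y w))"
proof -
  have XM: "X \<in> measurable M N"
    using A X by (rule measurable_from_subalg)
  interpret X: prob_space "distr M N X"
    by (rule prob_space_distr) fact
  interpret Y: prob_space "distr M N' Y"
    by (rule prob_space_distr) fact
  interpret P: pair_prob_space "distr M N X" "distr M N' Y" ..
  show ?thesis
  proof (rule pair_measure_eqI)
    fix B C assume "B \<in> sets (distr M N X)" "C \<in> sets (distr M N' Y)"
    then have B[measurable]: "B \<in> sets N" and C[measurable]: "C \<in> sets N'"
      by auto
    have "X -` B \<inter> space M \<in> sets A"
      using measurable_sets[OF X B] A by (simp add: subalgebra_def)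
    then have "prob ((X -` B \<inter> space M) \<inter> (Y -` C \<inter> space M))
        = prob (X -` B \<inter> space M) * prob (Y -` C \<inter> space M)"
      using ind C unfolding indep_sets2_eq by blast
    moreover have "(X -` B \<inter> space M) \<inter> (Y -` C \<inter> space M)
        = (\<lambda>w. (X w, Y w)) -` (B \<times> C) \<inter> space M"
      by auto
    ultimately show "emeasure (distr M N X) B * emeasure (distr M N' Y) C
        = emeasure (distr M (N \<Otimes>\<^sub>M N') (\<lambda>w. (X w, Y w))) (B \<times> C)"
      using XM Y
      by (simp add: emeasure_distr emeasure_eq_measure ennreal_mult)
  qed (auto intro!: X.sigma_finite_measure_axioms Y.sigma_finite_measure_axioms
         cong: sets_pair_measure_cong)
qed

text \<open>Tonelli for the product law: \<open>Y\<close> is integrated out while \<open>X\<close>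
  is held fixed. This form serves to establish finiteness of second moments.\<close>

lemma nn_integral_frozen:
  assumes A: "subalgebra M A"
    and ind: "indep_set (sets A) {Y -` C \<inter> space M | C. C \<in> sets N'}"
    and X: "X \<in> measurable A N" and Y: "Y \<in> measurable M N'"
    and h: "h \<in> borel_measurable (N \<Otimes>\<^sub>M N')"
  shows "(\<integral>\<^sup>+w. h (X w, Y w) \<partial>M) = (\<integral>\<^sup>+w. \<integral>\<^sup>+y. h (X w, y) \<partial>distr M N' Y \<partial>M)"
proof -
  have XM[measurable]: "X \<in> measurable M N"
    using A X by (rule measurable_from_subalg)
  note Y[measurable] h[measurable]
  interpret Y: prob_space "distr M N' Y"
    by (rule prob_space_distr) fact
  have "(\<integral>\<^sup>+w. h (X w, Y w) \<partial>M) = (\<integral>\<^sup>+z. h z \<partial>distr M (N \<Otimes>\<^sub>M N') (\<lambda>w. (X w, Y w)))"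
    by (subst nn_integral_distr) auto
  also have "\<dots> = (\<integral>\<^sup>+z. h z \<partial>(distr M N X \<Otimes>\<^sub>M distr M N' Y))"
    unfolding distr_pair_independent[OF A ind X Y] ..
  also have "\<dots> = (\<integral>\<^sup>+x. \<integral>\<^sup>+y. h (x, y) \<partial>distr M N' Y \<partial>distr M N X)"
    by (subst Y.nn_integral_fst) (auto cong: measurable_cong_sets)
  also have "\<dots> = (\<integral>\<^sup>+w. \<integral>\<^sup>+y. h (X w, y) \<partial>distr M N' Y \<partial>M)"
    by (subst nn_integral_distr) auto
  finally show ?thesis .
qed

text \<open>Fubini for the same product law; integrability of the composed function transfers to the
  product measure.\<close>

lemma integral_frozen:
  fixes h :: "_ \<Rightarrow> _::{banach, second_countable_topology}"
  assumes A: "subalgebra M A"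
    and ind: "indep_set (sets A) {Y -` C \<inter> space M | C. C \<in> sets N'}"
    and X: "X \<in> measurable A N" and Y: "Y \<in> measurable M N'"
    and h: "h \<in> borel_measurable (N \<Otimes>\<^sub>M N')"
    and int: "integrable M (\<lambda>w. h (X w, Y w))"
  shows "(\<integral>w. h (X w, Y w) \<partial>M) = (\<integral>w. \<integral>y. h (X w, y) \<partial>distr M N' Y \<partial>M)"
proof -
  have XM[measurable]: "X \<in> measurable M N"
    using A X by (rule measurable_from_subalg)
  note Y[measurable] h[measurable]
  interpret X: prob_space "distr M N X"
    by (rule prob_space_distr) fact
  interpret Y: prob_space "distr M N' Y"
    by (rule prob_space_distr) fact
  interpret P: pair_prob_space "distr M N X" "distr M N' Y" ..
  have int': "integrable (distr M N X \<Otimes>\<^sub>M distr M N' Y) h"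
    unfolding distr_pair_independent[OF A ind X Y]
    using int by (subst integrable_distr_eq) auto
  have "(\<integral>w. h (X w, Y w) \<partial>M) = (\<integral>z. h z \<partial>distr M (N \<Otimes>\<^sub>M N') (\<lambda>w. (X w, Y w)))"
    by (subst integral_distr) auto
  also have "\<dots> = (\<integral>z. h z \<partial>(distr M N X \<Otimes>\<^sub>M distr M N' Y))"
    unfolding distr_pair_independent[OF A ind X Y] ..
  also have "\<dots> = (\<integral>x. \<integral>y. h (x, y) \<partial>distr M N' Y \<partial>distr M N X)"
    using P.integral_fst'[OF int'] by simp
  also have "\<dots> = (\<integral>w. \<integral>y. h (X w, y) \<partial>distr M N' Y \<partial>M)"
    by (subst integral_distr) (auto intro!: Y.borel_measurable_lebesgue_integral)
  finally show ?thesis .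
qed

text \<open>Once \<open>X\<close> and \<open>U\<close> are frozen, \<open>q (X, Y)\<close> has mean
  zero, so its inner product with \<open>U\<close> averages to zero. This is the source of all
  vanishing cross terms.\<close>

lemma orthogonal_vars_frozen:
  fixes q :: "_ \<Rightarrow> 'e::euclidean_space"
  assumes A: "subalgebra M A"
    and ind: "indep_set (sets A) {Y -` C \<inter> space M | C. C \<in> sets N'}"
    and X: "X \<in> measurable A N" and Y: "Y \<in> measurable M N'"
    and q: "q \<in> borel_measurable (N \<Otimes>\<^sub>M N')"
    and mean: "\<And>x. integrable (distr M N' Y) (\<lambda>y. q (x, y))"
      "\<And>x. (\<integral>y. q (x, y) \<partial>distr M N' Y) = 0"
    and U: "U \<in> borel_measurable A" "sq_integrable M U"
    and V: "sq_integrable M (\<lambda>w. q (X w, Y w))"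
  shows "orthogonal_vars M U (\<lambda>w. q (X w, Y w))"
proof -
  note q[measurable]
  have "(\<lambda>z. inner (fst (fst z)) (q (snd (fst z), snd z))) \<in> borel_measurable ((borel \<Otimes>\<^sub>M N) \<Otimes>\<^sub>M N')"
    by measurable
  then have "(\<integral>w. inner (U w) (q (X w, Y w)) \<partial>M)
      = (\<integral>w. \<integral>y. inner (U w) (q (X w, y)) \<partial>distr M N' Y \<partial>M)"
    using integral_frozen[OF A ind, of "\<lambda>w. (U w, X w)" "borel \<Otimes>\<^sub>M N"
        "\<lambda>z. inner (fst (fst z)) (q (snd (fst z), snd z))"] X Y U sq_integrable_inner[OF U(2) V]
    by simp
  also have "\<dots> = 0"
    using mean by simp
  finally show ?thesis
    using U V unfolding orthogonal_vars_def by simp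
qed

end

section \<open>The sources of randomness\<close>

text \<open>Bundles what the recursion for the estimator error rests on; the Polyak-Lojasiewicz
  condition and the bounds on the stepsize are added in the convergence lemmas.\<close>

locale vr_marina = prob_space M
  for M :: "'w measure" +
  fixes D :: "nat \<Rightarrow> 'xi measure"
    and F :: "'xi \<Rightarrow> real^'d \<Rightarrow> real"
    and QM :: "'q measure"
    and Q :: "'q \<Rightarrow> real^'d \<Rightarrow> real^'d"
    and n b b' :: nat
    and p \<gamma> \<omega> :: real
    and Ls \<L>s \<sigma>s :: "nat \<Rightarrow> real"
    and x0 :: "real^'d"
    and I I' :: "nat \<Rightarrow> nat \<Rightarrow> nat set"
    and xi :: "nat \<Rightarrow> nat \<Rightarrow> nat \<Rightarrow> 'w \<Rightarrow> 'xi"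
    and c :: "nat \<Rightarrow> 'w \<Rightarrow> bool"
    and s :: "nat \<Rightarrow> nat \<Rightarrow> 'w \<Rightarrow> 'q"
    and x g :: "nat \<Rightarrow> 'w \<Rightarrow> real^'d"
    and gw Dt :: "nat \<Rightarrow> nat \<Rightarrow> 'w \<Rightarrow> real^'d"
  assumes n: "n \<ge> 1" and b: "1 \<le> b'" "b' < b" and p: "0 < p" "p \<le> 1"
    and losses: "stochastic_losses D F n"
    and smooth: "\<And>i. i \<in> {1..n} \<Longrightarrow> smooth_with (Ls i) (local_loss D F i)"
    and variance: "\<And>i. i \<in> {1..n} \<Longrightarrow> bounded_variance (D i) F (local_loss D F i) (\<sigma>s i)"
    and quant: "quantization QM Q \<omega>"
    and batches: "\<And>i t. i \<in> {1..n} \<Longrightarrow> card (I i t) = b \<and> card (I' i t) = b'"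
    and sources: "independent_sources M D QM p n xi c s"
    and run: "vr_marina_online F Q n b b' \<gamma> x0 I I' xi c s x g gw Dt"
    and avg: "\<And>i. i \<in> {1..n} \<Longrightarrow> average_smooth M x (local_loss D F i) (\<lambda>k. Dt k i) b' (\<L>s i)"
begin

abbreviation fi :: "nat \<Rightarrow> real^'d \<Rightarrow> real" where "fi \<equiv> local_loss D F"

abbreviation f :: "real^'d \<Rightarrow> real" where "f \<equiv> global_loss D F n"

definition srcs :: "source set" where
  "srcs = {Sample t i j | t i j. i \<in> {1..n}} \<union> range Coin \<union> {Seed k i | k i. i \<in> {1..n}}"

lemma srcs_simps [simp]:
  "Sample t i j \<in> srcs \<longleftrightarrow> i \<in> {1..n}" "Coin k \<in> srcs" "Seed k i \<in> srcs \<longleftrightarrow> i \<in> {1..n}"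
  unfolding srcs_def by auto

abbreviation src_events :: "source \<Rightarrow> 'w set set" where
  "src_events \<equiv> source_events M D QM xi c s"

text \<open>Measurability with respect to \<open>info S\<close> expresses that a quantity is
  determined by the sources in \<open>S\<close>; freshness of a source means measurability without
  it.\<close>

definition info :: "source set \<Rightarrow> 'w measure" where
  "info S = sigma (space M) (\<Union>a\<in>S. src_events a)"

lemma indep_src_events: "indep_sets src_events srcs"
  using sources unfolding independent_sources_def srcs_def by blast

lemma src_events_subset: "a \<in> srcs \<Longrightarrow> src_events a \<subseteq> sets M"
  using indep_src_events unfolding indep_sets_def by blast

lemma src_events_Pow: "src_events a \<subseteq> Pow (space M)"
  unfolding source_events_def by (cases a) auto

lemma space_info [simp]: "space (info S) = space M"
  unfolding info_def using src_events_Pow by (intro space_measure_of) auto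

lemma sets_info: "sets (info S) = sigma_sets (space M) (\<Union>a\<in>S. src_events a)"
  unfolding info_def using src_events_Pow by (intro sets_measure_of) auto

lemma subalgebra_info: "S \<subseteq> srcs \<Longrightarrow> subalgebra M (info S)"
  unfolding subalgebra_def sets_info
  using src_events_subset by (auto intro!: sets.sigma_sets_subset)

lemma measurable_info_mono:
  assumes "h \<in> measurable (info S) N" "S \<subseteq> T"
  shows "h \<in> measurable (info T) N"
proof -
  have "sets (info S) \<subseteq> sets (info T)"
    unfolding sets_info using assms(2) by (intro sigma_sets_mono') auto
  then show ?thesis
    using assms(1) unfolding measurable_def by auto
qed

lemma measurable_info_imp:
  assumes "h \<in> measurable (info S) N" "S \<subseteq> srcs"
  shows "h \<in> measurable M N"
  using measurable_from_subalg subalgebra_info assms by blast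

lemma Sample_events: "src_events (Sample t i j) = {xi t i j -` A \<inter> space M | A. A \<in> sets (D i)}"
  and Coin_events: "src_events (Coin k) = {c k -` A \<inter> space M | A. A \<in> sets (count_space UNIV)}"
  and Seed_events: "src_events (Seed k i) = {s k i -` A \<inter> space M | A. A \<in> sets QM}"
  unfolding source_events_def by simp_all

lemma measurable_infoI:
  assumes "a \<in> S" "src_events a = {Y -` A \<inter> space M | A. A \<in> sets N}" "Y \<in> measurable M N"
  shows "Y \<in> measurable (info S) N"
proof (rule measurableI)
  fix A assume "A \<in> sets N"
  with assms have "Y -` A \<inter> space M \<in> (\<Union>a\<in>S. src_events a)"
    by blast
  then show "Y -` A \<inter> space (info S) \<in> sets (info S)"
    unfolding sets_info by (auto intro: sigma_sets.Basic)
qed (use assms in \<open>auto dest: measurable_space\<close>)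

lemma sample_rv: "i \<in> {1..n} \<Longrightarrow> xi t i j \<in> measurable M (D i)"
  and sample_law: "i \<in> {1..n} \<Longrightarrow> distr M (D i) (xi t i j) = D i"
  and coin_rv: "c k \<in> measurable M (count_space UNIV)"
  and coin_law: "distr M (count_space UNIV) (c k) = measure_pmf (bernoulli_pmf p)"
  and seed_rv: "i \<in> {1..n} \<Longrightarrow> s k i \<in> measurable M QM"
  and seed_law: "i \<in> {1..n} \<Longrightarrow> distr M QM (s k i) = QM"
  using sources unfolding independent_sources_def by blast+

lemma sample_measurable: "Sample t i j \<in> S \<Longrightarrow> i \<in> {1..n} \<Longrightarrow> xi t i j \<in> measurable (info S) (D i)"
  by (rule measurable_infoI[OF _ Sample_events sample_rv])

lemma coin_measurable: "Coin k \<in> S \<Longrightarrow> c k \<in> measurable (info S) (count_space UNIV)"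
  by (rule measurable_infoI[OF _ Coin_events coin_rv])

lemma seed_measurable: "Seed k i \<in> S \<Longrightarrow> i \<in> {1..n} \<Longrightarrow> s k i \<in> measurable (info S) QM"
  by (rule measurable_infoI[OF _ Seed_events seed_rv])

lemma src_events_Int_stable: "Int_stable (src_events a)"
  by (cases a) (simp_all only: Sample_events Coin_events Seed_events Int_stable_vimage)

text \<open>The generators are intersection-stable, so grouping the sources into \<open>a\<close>
  and all others keeps the generated sigma-algebras independent. Mutual independence is exploited
  only in this form.\<close>

lemma indep_info_others:
  assumes "a \<in> srcs"
  shows "indep_set (sets (info (srcs - {a}))) (src_events a)"
proof -
  let ?J = "case_bool (srcs - {a}) {a}"
  have "(\<Union>j. ?J j) = srcs"
    using assms by (auto simp: UNIV_bool)
  then have "indep_sets (\<lambda>j. sigma_sets (space M) (\<Union>i\<in>?J j. src_events i)) UNIV"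
    using indep_src_events src_events_Int_stable
    by (intro indep_sets_collect_sigma) (auto simp: disjoint_family_on_def split: bool.splits)
  then show ?thesis
    unfolding indep_set_def sets_info
    by (rule indep_sets_mono_sets) (auto split: bool.splits)
qed

lemmas indep_sample = indep_info_others[of "Sample t i j" for t i j, unfolded Sample_events]
lemmas indep_coin = indep_info_others[of "Coin k" for k, unfolded Coin_events]
lemmas indep_seed = indep_info_others[of "Seed k i" for k i, unfolded Seed_events]

text \<open>Neither branch depends on the coin, so both can be frozen while the Bernoulli law is
  integrated out.\<close>

lemma coin_integral:
  fixes U V :: "'w \<Rightarrow> real"
  assumes U: "U \<in> borel_measurable (info (srcs - {Coin k}))" "integrable M U"
    and V: "V \<in> borel_measurable (info (srcs - {Coin k}))" "integrable M V"
  shows "integrable M (\<lambda>w. if c k w then U w else V w)"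
    and "(\<integral>w. (if c k w then U w else V w) \<partial>M) = p * (\<integral>w. U w \<partial>M) + (1 - p) * (\<integral>w. V w \<partial>M)"
proof -
  have [measurable]: "c k \<in> measurable M (count_space UNIV)"
    by (rule coin_rv)
  show int: "integrable M (\<lambda>w. if c k w then U w else V w)"
  proof (rule Bochner_Integration.integrable_bound)
    show "integrable M (\<lambda>w. \<bar>U w\<bar> + \<bar>V w\<bar>)"
      using U V by auto
    have [measurable]: "U \<in> borel_measurable M" "V \<in> borel_measurable M"
      using U V by auto
    show "(\<lambda>w. if c k w then U w else V w) \<in> borel_measurable M"
      by measurable
  qed auto
  let ?h = "\<lambda>z :: (real \<times> real) \<times> bool. if snd z then fst (fst z) else snd (fst z)"
  have "(\<integral>w. ?h ((U w, V w), c k w) \<partial>M)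
      = (\<integral>w. \<integral>y. ?h ((U w, V w), y) \<partial>distr M (count_space UNIV) (c k) \<partial>M)"
    using U V int
    by (intro integral_frozen[OF subalgebra_info indep_coin, where N = "borel \<Otimes>\<^sub>M borel"])
       (auto cong: if_cong)
  also have "\<dots> = (\<integral>w. U w * p + V w * (1 - p) \<partial>M)"
    unfolding coin_law using p by simp
  finally show "(\<integral>w. (if c k w then U w else V w) \<partial>M)
      = p * (\<integral>w. U w \<partial>M) + (1 - p) * (\<integral>w. V w \<partial>M)"
    using U V by (simp add: mult.commute cong: if_cong)
qed

lemma coin_norm_sq:
  fixes U V :: "'w \<Rightarrow> 'e::euclidean_space"
  assumes U: "U \<in> borel_measurable (info (srcs - {Coin k}))" "sq_integrable M U"
    and V: "V \<in> borel_measurable (info (srcs - {Coin k}))" "sq_integrable M V"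
  shows "(\<integral>w. (norm (if c k w then U w else V w))\<^sup>2 \<partial>M)
    = p * (\<integral>w. (norm (U w))\<^sup>2 \<partial>M) + (1 - p) * (\<integral>w. (norm (V w))\<^sup>2 \<partial>M)"
proof -
  have "(\<integral>w. (norm (if c k w then U w else V w))\<^sup>2 \<partial>M)
      = (\<integral>w. (if c k w then (norm (U w))\<^sup>2 else (norm (V w))\<^sup>2) \<partial>M)"
    by (intro Bochner_Integration.integral_cong) auto
  also have "\<dots> = p * (\<integral>w. (norm (U w))\<^sup>2 \<partial>M) + (1 - p) * (\<integral>w. (norm (V w))\<^sup>2 \<partial>M)"
  proof (rule coin_integral(2))
    note U(1)[measurable] V(1)[measurable]
    show "(\<lambda>w. (norm (U w))\<^sup>2) \<in> borel_measurable (info (srcs - {Coin k}))"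
      "(\<lambda>w. (norm (V w))\<^sup>2) \<in> borel_measurable (info (srcs - {Coin k}))"
      by measurable
  qed (use U(2) V(2) in \<open>auto simp: sq_integrable_def\<close>)
  finally show ?thesis .
qed

section \<open>Noise of the stochastic gradients and of the quantization\<close>

lemma D_prob: "i \<in> {1..n} \<Longrightarrow> prob_space (D i)"
  and F_grad_measurable: "i \<in> {1..n} \<Longrightarrow> (\<lambda>(\<xi>, y). grad (F \<xi>) y) \<in> borel_measurable (D i \<Otimes>\<^sub>M borel)"
  using losses unfolding stochastic_losses_def by auto

lemma grad_fi_measurable [measurable]: "i \<in> {1..n} \<Longrightarrow> grad (fi i) \<in> borel_measurable borel"
  using smooth_with_continuous_grad[OF smooth] by (rule borel_measurable_continuous_onI)

text \<open>The point \<open>y\<close> is itself random, because stochastic gradients are evaluated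
  at iterates.\<close>

definition noise :: "nat \<Rightarrow> nat \<Rightarrow> nat \<Rightarrow> ('w \<Rightarrow> real^'d) \<Rightarrow> 'w \<Rightarrow> real^'d" where
  "noise t i j y w = grad (F (xi t i j w)) (y w) - grad (fi i) (y w)"

lemma sample_grad_measurable:
  assumes "i \<in> {1..n}" "xi t i j \<in> measurable N (D i)" "y \<in> borel_measurable N"
  shows "(\<lambda>w. grad (F (xi t i j w)) (y w)) \<in> borel_measurable N"
  using measurable_compose[OF measurable_Pair[OF assms(2,3)] F_grad_measurable[OF assms(1)]] by simp

lemma noise_measurable:
  assumes "i \<in> {1..n}" "xi t i j \<in> measurable N (D i)" "y \<in> borel_measurable N"
  shows "noise t i j y \<in> borel_measurable N"
  unfolding noise_def
  by (intro borel_measurable_diff sample_grad_measurable assms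
      measurable_compose[OF assms(3) grad_fi_measurable])

lemma noise_map_measurable:
  assumes "i \<in> {1..n}"
  shows "(\<lambda>z. grad (F (snd z)) (fst z) - grad (fi i) (fst z)) \<in> borel_measurable (borel \<Otimes>\<^sub>M D i)"
proof -
  have "(\<lambda>z. (snd z, fst z)) \<in> measurable (borel \<Otimes>\<^sub>M D i) (D i \<Otimes>\<^sub>M borel)"
    by measurable
  from measurable_compose[OF this F_grad_measurable[OF assms]]
  have [measurable]: "(\<lambda>z. grad (F (snd z)) (fst z)) \<in> borel_measurable (borel \<Otimes>\<^sub>M D i)"
    by simp
  have [measurable]: "(\<lambda>z. grad (fi i) (fst z)) \<in> borel_measurable (borel \<Otimes>\<^sub>M D i)"
    using assms by measurable
  show ?thesis
    by measurable
qed

text \<open>The variance bound is uniform in the point, so it applies at every frozen value of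
  \<open>y\<close>.\<close>

lemma noise_second_moment:
  assumes i: "i \<in> {1..n}" and y: "y \<in> borel_measurable (info (srcs - {Sample t i j}))"
  shows "sq_integrable M (noise t i j y)" "(\<integral>w. (norm (noise t i j y w))\<^sup>2 \<partial>M) \<le> (\<sigma>s i)\<^sup>2"
proof -
  let ?q = "\<lambda>z. grad (F (snd z)) (fst z) - grad (fi i) (fst z)"
  note noise_map_measurable[OF i, measurable]
  have "(\<integral>\<^sup>+w. ennreal ((norm (?q (y w, xi t i j w)))\<^sup>2) \<partial>M)
      = (\<integral>\<^sup>+w. \<integral>\<^sup>+\<xi>. ennreal ((norm (?q (y w, \<xi>)))\<^sup>2) \<partial>D i \<partial>M)"
    by (subst nn_integral_frozen[OF subalgebra_info indep_sample y sample_rv])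
       (use i in \<open>auto simp: sample_law simp del: fst_conv snd_conv\<close>)
  also have "\<dots> \<le> (\<integral>\<^sup>+w. ennreal ((\<sigma>s i)\<^sup>2) \<partial>M)"
  proof (rule nn_integral_mono)
    fix w
    have "(\<integral>\<^sup>+\<xi>. ennreal ((norm (?q (y w, \<xi>)))\<^sup>2) \<partial>D i)
        = ennreal (\<integral>\<xi>. (norm (grad (F \<xi>) (y w) - grad (fi i) (y w)))\<^sup>2 \<partial>D i)"
      using variance[OF i] unfolding bounded_variance_def by (simp add: nn_integral_eq_integral)
    also have "\<dots> \<le> ennreal ((\<sigma>s i)\<^sup>2)"
      using variance[OF i] unfolding bounded_variance_def by (intro ennreal_leI) blast
    finally show "(\<integral>\<^sup>+\<xi>. ennreal ((norm (?q (y w, \<xi>)))\<^sup>2) \<partial>D i) \<le> ennreal ((\<sigma>s i)\<^sup>2)" .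
  qed
  also have "\<dots> = ennreal ((\<sigma>s i)\<^sup>2)"
    by (simp add: emeasure_space_1)
  finally have nn: "(\<integral>\<^sup>+w. ennreal ((norm (noise t i j y w))\<^sup>2) \<partial>M) \<le> ennreal ((\<sigma>s i)\<^sup>2)"
    unfolding noise_def by simp
  have "noise t i j y \<in> borel_measurable M"
    by (rule noise_measurable[OF i sample_rv[OF i] measurable_info_imp[OF y]]) auto
  from sq_integrableI_nn_integral[OF this _ nn]
  show "sq_integrable M (noise t i j y)" "(\<integral>w. (norm (noise t i j y w))\<^sup>2 \<partial>M) \<le> (\<sigma>s i)\<^sup>2"
    by auto
qed

lemma noise_orthogonal:
  assumes i: "i \<in> {1..n}" and y: "y \<in> borel_measurable (info (srcs - {Sample t i j}))"
    and U: "U \<in> borel_measurable (info (srcs - {Sample t i j}))" "sq_integrable M U"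
  shows "orthogonal_vars M U (noise t i j y)"
proof -
  interpret Di: prob_space "D i"
    using i by (rule D_prob)
  let ?q = "\<lambda>z. grad (F (snd z)) (fst z) - grad (fi i) (fst z)"
  have "orthogonal_vars M U (\<lambda>w. ?q (y w, xi t i j w))"
  proof (rule orthogonal_vars_frozen[OF subalgebra_info indep_sample y sample_rv[OF i]])
    show "sq_integrable M (\<lambda>w. ?q (y w, xi t i j w))"
      using noise_second_moment(1)[OF i y] unfolding noise_def by simp
    fix v
    have *: "integrable (D i) (\<lambda>\<xi>. grad (F \<xi>) v)" "(\<integral>\<xi>. grad (F \<xi>) v \<partial>D i) = grad (fi i) v"
      using variance[OF i] unfolding bounded_variance_def by blast+
    then show "integrable (distr M (D i) (xi t i j)) (\<lambda>\<xi>. ?q (v, \<xi>))"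
      "(\<integral>\<xi>. ?q (v, \<xi>) \<partial>distr M (D i) (xi t i j)) = 0"
      unfolding sample_law[OF i] by (simp_all add: Di.prob_space)
  qed (use i U noise_map_measurable[OF i] in auto)
  then show ?thesis
    unfolding noise_def by simp
qed

section \<open>Noise of the quantization\<close>

lemma Q_prob: "prob_space QM"
  and omega_pos: "\<omega> > 0"
  and Q_joint_measurable: "(\<lambda>(v, y). Q v y) \<in> borel_measurable (QM \<Otimes>\<^sub>M borel)"
  and Q_integrable: "integrable QM (\<lambda>v. Q v y)"
  and Q_mean: "(\<integral>v. Q v y \<partial>QM) = y"
  and Q_sq_integrable: "integrable QM (\<lambda>v. (norm (Q v y - y))\<^sup>2)"
  and Q_variance: "(\<integral>v. (norm (Q v y - y))\<^sup>2 \<partial>QM) \<le> \<omega> * (norm y)\<^sup>2"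
  using quant unfolding quantization_def by auto

lemma Q_measurable:
  assumes "s k i \<in> measurable N QM" "y \<in> borel_measurable N"
  shows "(\<lambda>w. Q (s k i w) (y w)) \<in> borel_measurable N"
  using measurable_compose[OF measurable_Pair[OF assms] Q_joint_measurable] by simp

lemma Q_swap_measurable: "(\<lambda>z. Q (snd z) (fst z)) \<in> borel_measurable (borel \<Otimes>\<^sub>M QM)"
proof -
  have "(\<lambda>z. (snd z, fst z)) \<in> measurable (borel \<Otimes>\<^sub>M QM) (QM \<Otimes>\<^sub>M borel)"
    by measurable
  from measurable_compose[OF this Q_joint_measurable] show ?thesis
    by simp
qed

text \<open>The seed is fresh, so the variance bound of \<open>Q\<close> applies at each frozen
  input. That bound grows with the input, which is why \<open>y\<close> must be square-integrable
  here.\<close>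

lemma quantization_noise_second_moment:
  assumes i: "i \<in> {1..n}" and y: "y \<in> borel_measurable (info (srcs - {Seed k i}))" "sq_integrable M y"
  shows "sq_integrable M (\<lambda>w. Q (s k i w) (y w) - y w)"
    "(\<integral>w. (norm (Q (s k i w) (y w) - y w))\<^sup>2 \<partial>M) \<le> \<omega> * (\<integral>w. (norm (y w))\<^sup>2 \<partial>M)"
proof -
  let ?q = "\<lambda>z. Q (snd z) (fst z) - fst z"
  note Q_swap_measurable[measurable]
  have "(\<integral>\<^sup>+w. ennreal ((norm (?q (y w, s k i w)))\<^sup>2) \<partial>M)
      = (\<integral>\<^sup>+w. \<integral>\<^sup>+v. ennreal ((norm (?q (y w, v)))\<^sup>2) \<partial>QM \<partial>M)"
    by (subst nn_integral_frozen[OF subalgebra_info indep_seed y(1) seed_rv])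
       (use i in \<open>auto simp: seed_law simp del: fst_conv snd_conv\<close>)
  also have "\<dots> \<le> (\<integral>\<^sup>+w. ennreal (\<omega> * (norm (y w))\<^sup>2) \<partial>M)"
    using Q_sq_integrable Q_variance
    by (intro nn_integral_mono) (simp add: nn_integral_eq_integral ennreal_leI)
  also have "\<dots> = ennreal (\<omega> * (\<integral>w. (norm (y w))\<^sup>2 \<partial>M))"
    using y(2) omega_pos unfolding sq_integrable_def by (subst nn_integral_eq_integral) auto
  finally have nn: "(\<integral>\<^sup>+w. ennreal ((norm (Q (s k i w) (y w) - y w))\<^sup>2) \<partial>M)
      \<le> ennreal (\<omega> * (\<integral>w. (norm (y w))\<^sup>2 \<partial>M))"
    by simp
  have "(\<lambda>w. Q (s k i w) (y w) - y w) \<in> borel_measurable M"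
    using y(2) unfolding sq_integrable_def
    by (intro borel_measurable_diff Q_measurable seed_rv i) auto
  from sq_integrableI_nn_integral[OF this _ nn] omega_pos
  show "sq_integrable M (\<lambda>w. Q (s k i w) (y w) - y w)"
    "(\<integral>w. (norm (Q (s k i w) (y w) - y w))\<^sup>2 \<partial>M) \<le> \<omega> * (\<integral>w. (norm (y w))\<^sup>2 \<partial>M)"
    by auto
qed

lemma quantization_noise_orthogonal:
  assumes i: "i \<in> {1..n}" and y: "y \<in> borel_measurable (info (srcs - {Seed k i}))" "sq_integrable M y"
    and U: "U \<in> borel_measurable (info (srcs - {Seed k i}))" "sq_integrable M U"
  shows "orthogonal_vars M U (\<lambda>w. Q (s k i w) (y w) - y w)"
proof -
  interpret QM: prob_space QM
    by (rule Q_prob)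
  note Q_swap_measurable[measurable]
  let ?q = "\<lambda>z. Q (snd z) (fst z) - fst z"
  have "orthogonal_vars M U (\<lambda>w. ?q (y w, s k i w))"
  proof (rule orthogonal_vars_frozen[OF subalgebra_info indep_seed y(1) seed_rv[OF i]])
    show "sq_integrable M (\<lambda>w. ?q (y w, s k i w))"
      using quantization_noise_second_moment(1)[OF i y] by simp
    show "integrable (distr M QM (s k i)) (\<lambda>u. ?q (v, u))"
      "(\<integral>u. ?q (v, u) \<partial>distr M QM (s k i)) = 0" for v
      unfolding seed_law[OF i] using Q_integrable Q_mean by (simp_all add: QM.prob_space)
  qed (use i U in auto)
  then show ?thesis
    by simp
qed

end

section \<open>The iterates\<close>

context vr_marina
begin

lemma x_0: "x 0 w = x0"
  and g_0: "g 0 w = (1 / (real n * real b)) *\<^sub>R (\<Sum>i=1..n. \<Sum>j\<in>I i 0. grad (F (xi 0 i j w)) x0)"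
  and x_Suc: "x (Suc k) w = x k w - \<gamma> *\<^sub>R g k w"
  and Dt_eq: "Dt k i w = (1 / real b') *\<^sub>R (\<Sum>j\<in>I' i (Suc k).
                 grad (F (xi (Suc k) i j w)) (x (Suc k) w) - grad (F (xi (Suc k) i j w)) (x k w))"
  and gw_Suc: "gw (Suc k) i w =
                 (if c k w
                  then (1 / real b) *\<^sub>R (\<Sum>j\<in>I i (Suc k). grad (F (xi (Suc k) i j w)) (x (Suc k) w))
                  else g k w + Q (s k i w) (Dt k i w))"
  and g_Suc: "g (Suc k) w = (1 / real n) *\<^sub>R (\<Sum>i=1..n. gw (Suc k) i w)"
  using run unfolding vr_marina_online_def by blast+

lemma gw_0: "gw 0 i w = (1 / real b) *\<^sub>R (\<Sum>j\<in>I i 0. grad (F (xi 0 i j w)) x0)"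
  using run unfolding vr_marina_online_def by blast

lemma batch_size: "i \<in> {1..n} \<Longrightarrow> card (I i t) = b" "i \<in> {1..n} \<Longrightarrow> card (I' i t) = b'"
  using batches by auto

text \<open>An infinite set has \<open>card\<close> 0, so a positive batch size forces
  finiteness.\<close>

lemma batch_finite: "i \<in> {1..n} \<Longrightarrow> finite (I i t)" "i \<in> {1..n} \<Longrightarrow> finite (I' i t)"
  using b batch_size card_ge_0_finite by (metis gr0I less_nat_zero_code not_one_le_zero)+

lemma global_loss_eq: "f = (\<lambda>y. (1 / real n) * (\<Sum>i=1..n. fi i y))"
  unfolding global_loss_def by (rule ext) simp

lemma grad_f: "grad f y = (1 / real n) *\<^sub>R (\<Sum>i=1..n. grad (fi i) y)"
  unfolding global_loss_eq using n smooth by (rule smooth_with_average(2))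

definition L :: real where "L = sqrt ((1 / real n) * (\<Sum>i=1..n. (Ls i)\<^sup>2))"

lemma smooth_f: "smooth_with L f"
  unfolding global_loss_eq L_def using n smooth by (rule smooth_with_average(1))

lemma grad_f_measurable [measurable]: "grad f \<in> borel_measurable borel"
  using smooth_with_continuous_grad[OF smooth_f] by (rule borel_measurable_continuous_onI)

lemma f_measurable [measurable]: "f \<in> borel_measurable borel"
  using smooth_with_continuous[OF smooth_f] by (rule borel_measurable_continuous_onI)

text \<open>What determines \<open>x k\<close> and \<open>g k\<close>. Samples are included up to
  round \<open>k\<close> but coins and seeds only below \<open>k\<close>, since round 0 is the
  initialization and iteration \<open>k\<close> draws the samples of round
  \<open>k + 1\<close>.\<close>

definition past :: "nat \<Rightarrow> source set" where
  "past k = {a \<in> srcs. case a of Sample t _ _ \<Rightarrow> t \<le> k | Coin j \<Rightarrow> j < k | Seed j _ \<Rightarrow> j < k}"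

lemma past_simps [simp]:
  "Sample t i j \<in> past k \<longleftrightarrow> i \<in> {1..n} \<and> t \<le> k" "Coin j \<in> past k \<longleftrightarrow> j < k"
  "Seed j i \<in> past k \<longleftrightarrow> i \<in> {1..n} \<and> j < k"
  unfolding past_def by auto

lemma past_subset: "past k \<subseteq> srcs" "past k \<subseteq> past (Suc k)"
  unfolding past_def by (auto split: source.splits)

section \<open>Measurability of the iterates\<close>

lemma Dt_measurable:
  assumes i: "i \<in> {1..n}"
    and xk: "x k \<in> borel_measurable N" "x (Suc k) \<in> borel_measurable N"
    and xi: "\<And>j. xi (Suc k) i j \<in> measurable N (D i)"
  shows "Dt k i \<in> borel_measurable N"
  unfolding Dt_eq
  by (intro borel_measurable_scaleR borel_measurable_const borel_measurable_sum
      borel_measurable_diff sample_grad_measurable assms)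

lemma gw_measurable:
  assumes i: "i \<in> {1..n}"
    and xk: "x k \<in> borel_measurable N" "x (Suc k) \<in> borel_measurable N" "g k \<in> borel_measurable N"
    and xi: "\<And>j. xi (Suc k) i j \<in> measurable N (D i)"
    and c: "c k \<in> measurable N (count_space UNIV)" and s: "s k i \<in> measurable N QM"
  shows "gw (Suc k) i \<in> borel_measurable N"
proof -
  note c[measurable]
  have "Measurable.pred N (c k)"
    by measurable
  then show ?thesis
    unfolding gw_Suc
    by (intro measurable_If borel_measurable_scaleR borel_measurable_const borel_measurable_sum
        borel_measurable_add sample_grad_measurable Q_measurable Dt_measurable assms)
       auto
qed

lemma iterate_measurable:
  shows "x k \<in> borel_measurable (info (past k))" "g k \<in> borel_measurable (info (past k))"
proof (induction k)
  case 0
  show "x 0 \<in> borel_measurable (info (past 0))"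
    by (subst x_0[abs_def]) simp
  have "xi 0 i j \<in> measurable (info (past 0)) (D i)" if "i \<in> {1..n}" for i j
    using that by (intro sample_measurable) auto
  then show "g 0 \<in> borel_measurable (info (past 0))"
    unfolding g_0
    by (intro borel_measurable_scaleR borel_measurable_const borel_measurable_sum
        sample_grad_measurable) auto
next
  case (Suc k)
  note IH = Suc[THEN measurable_info_mono, OF past_subset(2)]
  show xS: "x (Suc k) \<in> borel_measurable (info (past (Suc k)))"
    unfolding x_Suc using IH by measurable
  have "gw (Suc k) i \<in> borel_measurable (info (past (Suc k)))" if "i \<in> {1..n}" for i
    using that
    by (intro gw_measurable IH xS sample_measurable coin_measurable seed_measurable) auto
  then show "g (Suc k) \<in> borel_measurable (info (past (Suc k)))"
    unfolding g_Suc by (intro borel_measurable_scaleR borel_measurable_const borel_measurable_sum)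
qed

text \<open>The step uses only \<open>x k\<close> and \<open>g k\<close>, so the next iterate is
  known before iteration \<open>k\<close> draws anything. Hence the samples of round
  \<open>Suc k\<close> are fresh at both \<open>x k\<close> and \<open>x (Suc k)\<close>.\<close>

lemma x_Suc_measurable: "x (Suc k) \<in> borel_measurable (info (past k))"
  unfolding x_Suc using iterate_measurable[of k] by measurable

lemma iterate_measurable_info:
  assumes "past k \<subseteq> S"
  shows "x k \<in> borel_measurable (info S)" "g k \<in> borel_measurable (info S)"
    "x (Suc k) \<in> borel_measurable (info S)"
  using iterate_measurable[of k] x_Suc_measurable assms by (blast intro: measurable_info_mono)+

lemma iterate_rv: "x k \<in> borel_measurable M" "g k \<in> borel_measurable M"
  using iterate_measurable[of k] past_subset(1) by (blast intro: measurable_info_imp)+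

lemma past_fresh:
  "past k \<subseteq> srcs - {Sample (Suc k) i j}" "past k \<subseteq> srcs - {Coin k}" "past k \<subseteq> srcs - {Seed k i}"
  unfolding past_def by auto

section \<open>Square-integrability of the iterates\<close>

lemma sq_integrable_grad_fi:
  assumes i: "i \<in> {1..n}" and y: "sq_integrable M y"
  shows "sq_integrable M (\<lambda>w. grad (fi i) (y w))"
proof -
  have [measurable]: "y \<in> borel_measurable M" and [measurable]: "grad (fi i) \<in> borel_measurable borel"
    using y i unfolding sq_integrable_def by auto
  \<comment> \<open>Lipschitz continuity gives linear growth of the gradient relative to its value
    at 0.\<close>
  have "sq_integrable M (\<lambda>w. grad (fi i) (y w) - grad (fi i) 0)"
  proof (rule sq_integrable_bound[OF y])
    show "norm (grad (fi i) (y w) - grad (fi i) 0) \<le> Ls i * norm (y w)" for w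
      using smooth[OF i] unfolding smooth_with_def by (metis diff_zero)
  qed measurable
  from sq_integrable_add[OF this sq_integrable_const[of "grad (fi i) 0"]] show ?thesis
    by simp
qed

lemma sq_integrable_grad_f:
  assumes "sq_integrable M y"
  shows "sq_integrable M (\<lambda>w. grad f (y w))"
  unfolding grad_f using assms
  by (intro sq_integrable_scaleR sq_integrable_sum sq_integrable_grad_fi)

lemma sq_integrable_sample_grad:
  assumes i: "i \<in> {1..n}" and y: "y \<in> borel_measurable (info (srcs - {Sample t i j}))" "sq_integrable M y"
  shows "sq_integrable M (\<lambda>w. grad (F (xi t i j w)) (y w))"
  using sq_integrable_add[OF noise_second_moment(1)[OF i y(1)] sq_integrable_grad_fi[OF i y(2)]]
  unfolding noise_def by simp

lemma sq_integrable_Dt: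
  assumes i: "i \<in> {1..n}" and x: "sq_integrable M (x k)" "sq_integrable M (x (Suc k))"
  shows "sq_integrable M (Dt k i)"
  unfolding Dt_eq
  by (intro sq_integrable_scaleR sq_integrable_sum sq_integrable_diff sq_integrable_sample_grad
      i x iterate_measurable_info past_fresh)

lemma Dt_measurable_info:
  assumes "i \<in> {1..n}" "past k \<subseteq> S" "\<And>j. Sample (Suc k) i j \<in> S"
  shows "Dt k i \<in> borel_measurable (info S)"
  using assms by (intro Dt_measurable iterate_measurable_info sample_measurable) auto

lemma Dt_measurable_others:
  assumes "i \<in> {1..n}"
  shows "Dt k i \<in> borel_measurable (info (srcs - {Seed k j}))"
    "Dt k i \<in> borel_measurable (info (srcs - {Coin k}))"
  by (rule Dt_measurable_info[OF assms past_fresh(3)] Dt_measurable_info[OF assms past_fresh(2)],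
      use assms in simp)+

lemma sq_integrable_iterate: "sq_integrable M (x k)" "sq_integrable M (g k)"
proof (induction k)
  case 0
  show "sq_integrable M (x 0)"
    by (subst x_0[abs_def]) (rule sq_integrable_const)
  show "sq_integrable M (g 0)"
    unfolding g_0
    by (intro sq_integrable_scaleR sq_integrable_sum sq_integrable_sample_grad sq_integrable_const)
      auto
next
  case (Suc k)
  show xS: "sq_integrable M (x (Suc k))"
    unfolding x_Suc using Suc by (intro sq_integrable_diff sq_integrable_scaleR)
  have "sq_integrable M (gw (Suc k) i)" if i: "i \<in> {1..n}" for i
    unfolding gw_Suc
  proof (rule sq_integrable_If)
    show "sq_integrable M (\<lambda>w. (1 / real b) *\<^sub>R
        (\<Sum>j\<in>I i (Suc k). grad (F (xi (Suc k) i j w)) (x (Suc k) w)))"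
      by (intro sq_integrable_scaleR sq_integrable_sum sq_integrable_sample_grad i xS
          iterate_measurable_info past_fresh)
    \<comment> \<open>The quantized vector is split into noise and input, because the moment bound
      is available for the noise.\<close>
    have "sq_integrable M (\<lambda>w. (Q (s k i w) (Dt k i w) - Dt k i w) + Dt k i w)"
      by (intro sq_integrable_add quantization_noise_second_moment(1) sq_integrable_Dt
          Dt_measurable_others i Suc xS)
    then show "sq_integrable M (\<lambda>w. g k w + Q (s k i w) (Dt k i w))"
      using Suc by (intro sq_integrable_add) simp_all
    have [measurable]: "c k \<in> measurable M (count_space UNIV)"
      by (rule coin_rv)
    show "{w \<in> space M. c k w} \<in> sets M"
      by measurable
  qed
  then show "sq_integrable M (g (Suc k))"
    unfolding g_Suc by (intro sq_integrable_scaleR sq_integrable_sum)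
qed

section \<open>Recursion for the error of the gradient estimator\<close>

text \<open>As \<open>y\<close> is known without the samples of round \<open>t\<close>, each noise
  involves just one of these samples, and distinct noises are orthogonal. The variances of the
  \<open>n b\<close> noises therefore add up, and averaging leaves one factor
  \<open>1 / (n b)\<close>.\<close>

lemma batch_noise_second_moment:
  assumes y: "y \<in> borel_measurable (info S)" "S \<subseteq> srcs - {Sample t i j | i j. True}"
  shows "sq_integrable M (\<lambda>w. (1 / (real n * real b)) *\<^sub>R (\<Sum>i=1..n. \<Sum>j\<in>I i t. noise t i j y w))"
    and "(\<integral>w. (norm ((1 / (real n * real b)) *\<^sub>R (\<Sum>i=1..n. \<Sum>j\<in>I i t. noise t i j y w)))\<^sup>2 \<partial>M)
      \<le> (1 / real n) * (\<Sum>i=1..n. (\<sigma>s i)\<^sup>2) / (real n * real b)"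
proof -
  let ?A = "SIGMA i:{1..n}. I i t"
  let ?Z = "\<lambda>(i, j). noise t i j y"
  have A: "finite ?A"
    using batch_finite by auto
  have y': "y \<in> borel_measurable (info (srcs - {Sample t i j}))" for i j
    using y by (auto intro: measurable_info_mono)
  have sum_eq: "(\<Sum>i=1..n. \<Sum>j\<in>I i t. noise t i j y w) = (\<Sum>a\<in>?A. ?Z a w)" for w
    using batch_finite by (subst sum.Sigma) (auto intro!: sum.cong)
  have sq: "sq_integrable M (?Z a)" if "a \<in> ?A" for a
    using that noise_second_moment(1) y' by auto
  show "sq_integrable M (\<lambda>w. (1 / (real n * real b)) *\<^sub>R (\<Sum>i=1..n. \<Sum>j\<in>I i t. noise t i j y w))"
    unfolding sum_eq using sq by (intro sq_integrable_scaleR sq_integrable_sum)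
  have orth: "orthogonal_vars M (?Z a) (?Z a')" if "a \<in> ?A" "a' \<in> ?A" "a \<noteq> a'" for a a'
  proof -
    obtain i j i' j' where a: "a = (i, j)" "a' = (i', j')"
      by fastforce
    have i: "i \<in> {1..n}" "i' \<in> {1..n}"
      using that a by auto
    have "noise t i j y \<in> borel_measurable (info (srcs - {Sample t i' j'}))"
      using that i unfolding a by (intro noise_measurable sample_measurable y') auto
    with noise_orthogonal[OF i(2) y'] noise_second_moment(1)[OF i(1) y'] show ?thesis
      unfolding a by simp
  qed
  have "(\<integral>w. (norm (\<Sum>a\<in>?A. ?Z a w))\<^sup>2 \<partial>M) = (\<Sum>a\<in>?A. \<integral>w. (norm (?Z a w))\<^sup>2 \<partial>M)"
    using A sq orth by (rule orthogonal_vars_sum_norm_sq)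
  also have "\<dots> \<le> (\<Sum>a\<in>?A. (\<sigma>s (fst a))\<^sup>2)"
    using noise_second_moment(2) y' by (intro sum_mono) auto
  also have "\<dots> = (\<Sum>i=1..n. \<Sum>j\<in>I i t. (\<sigma>s i)\<^sup>2)"
    using batch_finite by (subst sum.Sigma) (auto intro!: sum.cong)
  also have "\<dots> = real b * (\<Sum>i=1..n. (\<sigma>s i)\<^sup>2)"
    using batch_size by (simp add: sum_distrib_left)
  finally have "(1 / (real n * real b))\<^sup>2 * (\<integral>w. (norm (\<Sum>a\<in>?A. ?Z a w))\<^sup>2 \<partial>M)
      \<le> (1 / (real n * real b))\<^sup>2 * (real b * (\<Sum>i=1..n. (\<sigma>s i)\<^sup>2))"
    by (rule mult_left_mono) simp
  also have "\<dots> = (1 / real n) * (\<Sum>i=1..n. (\<sigma>s i)\<^sup>2) / (real n * real b)"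
    using b n by (simp add: power2_eq_square)
  finally show "(\<integral>w. (norm ((1 / (real n * real b)) *\<^sub>R
      (\<Sum>i=1..n. \<Sum>j\<in>I i t. noise t i j y w)))\<^sup>2 \<partial>M)
      \<le> (1 / real n) * (\<Sum>i=1..n. (\<sigma>s i)\<^sup>2) / (real n * real b)"
    unfolding sum_eq by (simp add: power_mult_distrib power_divide)
qed

lemma batch_noise_eq:
  "(1 / (real n * real b)) *\<^sub>R (\<Sum>i=1..n. \<Sum>j\<in>I i t. grad (F (xi t i j w)) (y w)) - grad f (y w)
    = (1 / (real n * real b)) *\<^sub>R (\<Sum>i=1..n. \<Sum>j\<in>I i t. noise t i j y w)"
proof -
  have "(\<Sum>i=1..n. \<Sum>j\<in>I i t. grad (fi i) (y w)) = real b *\<^sub>R (\<Sum>i=1..n. grad (fi i) (y w))"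
    using batch_size by (simp add: scaleR_sum_right sum_constant_scaleR del: sum_constant)
  then show ?thesis
    using b n unfolding noise_def grad_f by (simp add: sum_subtractf scaleR_diff_right)
qed

section \<open>Noise of the stochastic gradient differences\<close>

definition grad_diff :: "nat \<Rightarrow> nat \<Rightarrow> 'w \<Rightarrow> real^'d" where
  "grad_diff k i w = grad (fi i) (x (Suc k) w) - grad (fi i) (x k w)"

lemma grad_diff_measurable:
  assumes "i \<in> {1..n}" "past k \<subseteq> S"
  shows "grad_diff k i \<in> borel_measurable (info S)"
  unfolding grad_diff_def
  by (intro borel_measurable_diff measurable_compose[OF _ grad_fi_measurable]
      iterate_measurable_info assms)

lemma sq_integrable_grad_diff: "i \<in> {1..n} \<Longrightarrow> sq_integrable M (grad_diff k i)"
  unfolding grad_diff_def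
  by (intro sq_integrable_diff sq_integrable_grad_fi sq_integrable_iterate)

lemma sq_integrable_step: "sq_integrable M (\<lambda>w. x (Suc k) w - x k w)"
  by (intro sq_integrable_diff sq_integrable_iterate)

lemma grad_diff_second_moment:
  assumes i: "i \<in> {1..n}"
  shows "(\<integral>w. (norm (grad_diff k i w))\<^sup>2 \<partial>M) \<le> (Ls i)\<^sup>2 * (\<integral>w. (norm (x (Suc k) w - x k w))\<^sup>2 \<partial>M)"
proof -
  have "(norm (grad_diff k i w))\<^sup>2 \<le> (Ls i)\<^sup>2 * (norm (x (Suc k) w - x k w))\<^sup>2" for w
    using smooth[OF i] unfolding smooth_with_def grad_diff_def power_mult_distrib[symmetric]
    by (intro power_mono) auto
  then have "(\<integral>w. (norm (grad_diff k i w))\<^sup>2 \<partial>M)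
      \<le> (\<integral>w. (Ls i)\<^sup>2 * (norm (x (Suc k) w - x k w))\<^sup>2 \<partial>M)"
    using sq_integrable_grad_diff[OF i] sq_integrable_step unfolding sq_integrable_def
    by (intro integral_mono) auto
  then show ?thesis
    by simp
qed

definition Dt_noise :: "nat \<Rightarrow> nat \<Rightarrow> 'w \<Rightarrow> real^'d" where
  "Dt_noise k i w = Dt k i w - grad_diff k i w"

text \<open>Expressed through sample noises at two points, orthogonality to the past follows from
  unbiasedness of the stochastic gradients. The factor -1 replaces subtraction so that the closure
  rules of \<open>orthogonal_vars\<close> apply.\<close>

lemma Dt_noise_eq:
  assumes i: "i \<in> {1..n}"
  shows "Dt_noise k i w = (1 / real b') *\<^sub>R (\<Sum>j\<in>I' i (Suc k).
           noise (Suc k) i j (x (Suc k)) w + (- 1) *\<^sub>R noise (Suc k) i j (x k) w)"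
proof -
  have "(\<Sum>j\<in>I' i (Suc k). grad_diff k i w) = real b' *\<^sub>R grad_diff k i w"
    using batch_size(2)[OF i] by (simp add: sum_constant_scaleR del: sum_constant)
  then have "(1 / real b') *\<^sub>R (\<Sum>j\<in>I' i (Suc k). grad_diff k i w) = grad_diff k i w"
    using b by simp
  then have "Dt_noise k i w = (1 / real b') *\<^sub>R (\<Sum>j\<in>I' i (Suc k).
      grad (F (xi (Suc k) i j w)) (x (Suc k) w) - grad (F (xi (Suc k) i j w)) (x k w) - grad_diff k i w)"
    unfolding Dt_noise_def Dt_eq sum_subtractf[of _ "\<lambda>_. grad_diff k i w"] scaleR_diff_right by simp
  also have "\<dots> = (1 / real b') *\<^sub>R (\<Sum>j\<in>I' i (Suc k).
           noise (Suc k) i j (x (Suc k)) w + (- 1) *\<^sub>R noise (Suc k) i j (x k) w)"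
    by (intro arg_cong2[where f = scaleR] sum.cong) (auto simp: noise_def grad_diff_def)
  finally show ?thesis .
qed

lemma sq_integrable_Dt_noise: "i \<in> {1..n} \<Longrightarrow> sq_integrable M (Dt_noise k i)"
  unfolding Dt_noise_def
  by (intro sq_integrable_diff sq_integrable_Dt sq_integrable_iterate sq_integrable_grad_diff)

lemma Dt_noise_orthogonal:
  assumes i: "i \<in> {1..n}" and U: "U \<in> borel_measurable (info S)" "sq_integrable M U"
    and S: "S \<subseteq> srcs - {Sample (Suc k) i j | j. True}"
  shows "orthogonal_vars M U (Dt_noise k i)"
proof -
  have "U \<in> borel_measurable (info (srcs - {Sample (Suc k) i j}))" for j
    using U(1) S by (auto intro: measurable_info_mono)
  then show ?thesis
    unfolding Dt_noise_eq[OF i]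
    by (intro orthogonal_vars_scaleR orthogonal_vars_sum orthogonal_vars_add noise_orthogonal
        i U(2) iterate_measurable_info past_fresh)
qed

text \<open>The two noises of one sample at neighbouring points are correlated, and average
  smoothness bounds their difference by the step length. Its conditional bound is integrated
  here.\<close>

lemma Dt_noise_second_moment:
  assumes i: "i \<in> {1..n}"
  shows "(\<integral>w. (norm (Dt_noise k i w))\<^sup>2 \<partial>M)
    \<le> (\<L>s i)\<^sup>2 / real b' * (\<integral>w. (norm (x (Suc k) w - x k w))\<^sup>2 \<partial>M)"
proof -
  note iterate_rv[measurable]
  let ?r = "\<lambda>w. (\<L>s i)\<^sup>2 / real b' * (norm (x (Suc k) w - x k w))\<^sup>2"
  let ?V = "\<lambda>w. ennreal ((norm (Dt_noise k i w))\<^sup>2)"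
  have "(\<lambda>w. (x k w, x (Suc k) w)) \<in> borel_measurable M"
    unfolding borel_prod[symmetric] by measurable
  then have "subalgebra M (step_algebra M x k)"
    unfolding subalgebra_def step_algebra_def by (auto simp: sets_vimage_algebra2)
  then interpret A: finite_measure_subalgebra M "step_algebra M x k"
    by unfold_locales
  have [measurable]: "Dt_noise k i \<in> borel_measurable M"
    using sq_integrable_Dt_noise[OF i] unfolding sq_integrable_def by blast
  have V: "?V \<in> borel_measurable M"
    by measurable
  have int: "integrable M ?r"
    using sq_integrable_step unfolding sq_integrable_def by auto
  have "(\<integral>\<^sup>+w. ?V w \<partial>M) = (\<integral>\<^sup>+w. nn_cond_exp M (step_algebra M x k) ?V w \<partial>M)"
    \<comment> \<open>Testing the conditional expectation against the constant 1 gives the total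
      expectation.\<close>
    using A.nn_cond_exp_intg[of "\<lambda>_. 1" ?V] V by simp
  also have "\<dots> \<le> (\<integral>\<^sup>+w. ennreal (?r w) \<partial>M)"
    using avg[OF i] unfolding average_smooth_def Dt_noise_def grad_diff_def
    by (intro nn_integral_mono_AE) blast
  also have "\<dots> = ennreal (\<integral>w. ?r w \<partial>M)"
    using int by (intro nn_integral_eq_integral) auto
  finally have "(\<integral>w. (norm (Dt_noise k i w))\<^sup>2 \<partial>M) \<le> (\<integral>w. ?r w \<partial>M)"
    using sq_integrable_Dt_noise[OF i] unfolding sq_integrable_def
    by (intro sq_integrableI_nn_integral(2)) auto
  then show ?thesis
    by simp
qed

section \<open>Noise of a worker's quantized difference\<close>

definition Q_noise :: "nat \<Rightarrow> nat \<Rightarrow> 'w \<Rightarrow> real^'d" where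
  "Q_noise k i w = Q (s k i w) (Dt k i w) - Dt k i w"

lemma Q_noise:
  assumes i: "i \<in> {1..n}"
  shows "sq_integrable M (Q_noise k i)"
    and "(\<integral>w. (norm (Q_noise k i w))\<^sup>2 \<partial>M) \<le> \<omega> * (\<integral>w. (norm (Dt k i w))\<^sup>2 \<partial>M)"
    and "U \<in> borel_measurable (info (srcs - {Seed k i})) \<Longrightarrow> sq_integrable M U
           \<Longrightarrow> orthogonal_vars M U (Q_noise k i)"
  unfolding Q_noise_def
  by (intro quantization_noise_second_moment quantization_noise_orthogonal i sq_integrable_Dt
      sq_integrable_iterate Dt_measurable_others | assumption)+

definition worker_noise :: "nat \<Rightarrow> nat \<Rightarrow> 'w \<Rightarrow> real^'d" where
  "worker_noise k i w = Dt_noise k i w + Q_noise k i w"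

lemma worker_noise_eq: "worker_noise k i w = Q (s k i w) (Dt k i w) - grad_diff k i w"
  unfolding worker_noise_def Dt_noise_def Q_noise_def by simp

lemma sq_integrable_worker_noise: "i \<in> {1..n} \<Longrightarrow> sq_integrable M (worker_noise k i)"
  unfolding worker_noise_def by (intro sq_integrable_add sq_integrable_Dt_noise Q_noise(1))

lemma worker_noise_measurable:
  assumes i: "i \<in> {1..n}" and S: "past k \<subseteq> S" "\<And>j. Sample (Suc k) i j \<in> S" "Seed k i \<in> S"
  shows "worker_noise k i \<in> borel_measurable (info S)"
  unfolding worker_noise_eq using assms
  by (intro borel_measurable_diff Q_measurable seed_measurable Dt_measurable_info
      grad_diff_measurable) auto

text \<open>Pythagoras twice: the quantization noise is orthogonal to \<open>Dt_noise\<close>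
  because the seed is fresh, and \<open>Dt_noise\<close> to \<open>grad_diff\<close> because the
  samples are. The noise of \<open>Dt\<close> counts once directly and \<open>\<omega>\<close> times
  through the quantization, whence \<open>1 + \<omega>\<close>.\<close>

lemma worker_noise_second_moment:
  assumes i: "i \<in> {1..n}"
  shows "(\<integral>w. (norm (worker_noise k i w))\<^sup>2 \<partial>M)
    \<le> (\<omega> * (Ls i)\<^sup>2 + (1 + \<omega>) * (\<L>s i)\<^sup>2 / real b') * (\<integral>w. (norm (x (Suc k) w - x k w))\<^sup>2 \<partial>M)"
proof -
  let ?r = "\<integral>w. (norm (x (Suc k) w - x k w))\<^sup>2 \<partial>M"
  let ?V = "\<integral>w. (norm (Dt_noise k i w))\<^sup>2 \<partial>M"
  have Dt: "(\<lambda>w. grad_diff k i w + Dt_noise k i w) = Dt k i"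
    unfolding Dt_noise_def by simp
  have "Dt_noise k i \<in> borel_measurable (info (srcs - {Seed k i}))"
    unfolding Dt_noise_def
    by (intro borel_measurable_diff Dt_measurable_others grad_diff_measurable past_fresh i)
  then have "orthogonal_vars M (Dt_noise k i) (Q_noise k i)"
    by (intro Q_noise(3) sq_integrable_Dt_noise i)
  then have "(\<integral>w. (norm (worker_noise k i w))\<^sup>2 \<partial>M) = ?V + (\<integral>w. (norm (Q_noise k i w))\<^sup>2 \<partial>M)"
    unfolding worker_noise_def by (rule orthogonal_vars_norm_sq)
  also have "\<dots> \<le> ?V + \<omega> * (\<integral>w. (norm (Dt k i w))\<^sup>2 \<partial>M)"
    using Q_noise(2)[OF i] by simp
  also have "(\<integral>w. (norm (Dt k i w))\<^sup>2 \<partial>M) = (\<integral>w. (norm (grad_diff k i w))\<^sup>2 \<partial>M) + ?V"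
  proof -
    have "orthogonal_vars M (grad_diff k i) (Dt_noise k i)"
      using i
      by (intro Dt_noise_orthogonal[of _ _ "past k"] grad_diff_measurable sq_integrable_grad_diff)
        (auto simp: past_def)
    from orthogonal_vars_norm_sq[OF this] show ?thesis
      unfolding Dt_noise_def by simp
  qed
  also have "?V + \<omega> * ((\<integral>w. (norm (grad_diff k i w))\<^sup>2 \<partial>M) + ?V)
      = \<omega> * (\<integral>w. (norm (grad_diff k i w))\<^sup>2 \<partial>M) + (1 + \<omega>) * ?V"
    by (simp add: algebra_simps)
  also have "\<dots> \<le> \<omega> * ((Ls i)\<^sup>2 * ?r) + (1 + \<omega>) * ((\<L>s i)\<^sup>2 / real b' * ?r)"
    using omega_pos
    by (intro add_mono mult_left_mono grad_diff_second_moment Dt_noise_second_moment i) auto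
  finally show ?thesis
    by (simp add: algebra_simps)
qed

lemma worker_noise_orthogonal:
  assumes i: "i \<in> {1..n}"
    and U: "U \<in> borel_measurable (info S)" "sq_integrable M U"
    and S: "S \<subseteq> srcs - {Sample (Suc k) i j | j. True}" "Seed k i \<notin> S"
  shows "orthogonal_vars M U (worker_noise k i)"
proof -
  have "U \<in> borel_measurable (info (srcs - {Seed k i}))"
    using U(1) S by (auto intro: measurable_info_mono)
  then show ?thesis
    unfolding worker_noise_def
    using Dt_noise_orthogonal[OF i U S(1)] Q_noise(3)[OF i _ U(2)] by (intro orthogonal_vars_add)
qed

section \<open>Error of the gradient estimator in one iteration\<close>

definition err :: "nat \<Rightarrow> 'w \<Rightarrow> real^'d" where
  "err k w = g k w - grad f (x k w)"

lemma sq_integrable_err: "sq_integrable M (err k)"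
  unfolding err_def by (intro sq_integrable_diff sq_integrable_grad_f sq_integrable_iterate)

lemma err_measurable:
  assumes "past k \<subseteq> S"
  shows "err k \<in> borel_measurable (info S)"
  unfolding err_def
  by (intro borel_measurable_diff measurable_compose[OF _ grad_f_measurable]
      iterate_measurable_info assms)

text \<open>In the notation of the theorem, \<open>\<sigma>\<^sup>2 / (n b)\<close>.\<close>

definition variance_term :: real where
  "variance_term = (1 / real n) * (\<Sum>i=1..n. (\<sigma>s i)\<^sup>2) / (real n * real b)"

text \<open>In the notation of the theorem,
  \<open>\<omega> L\<^sup>2 + (1 + \<omega>) \<L>\<^sup>2 / b'\<close>.\<close>

definition step_factor :: real where
  "step_factor = (1 / real n) * (\<Sum>i=1..n. \<omega> * (Ls i)\<^sup>2 + (1 + \<omega>) * (\<L>s i)\<^sup>2 / real b')"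

lemma err_0: "(\<integral>w. (norm (err 0 w))\<^sup>2 \<partial>M) \<le> variance_term"
proof -
  have "err 0 w = (1 / (real n * real b)) *\<^sub>R (\<Sum>i=1..n. \<Sum>j\<in>I i 0. noise 0 i j (\<lambda>_. x0) w)" for w
    unfolding err_def g_0 x_0 using batch_noise_eq[of 0 w "\<lambda>_. x0"] by simp
  then show ?thesis
    \<comment> \<open>A constant starting point is measurable for the empty set of sources.\<close>
    using batch_noise_second_moment(2)[of "\<lambda>_. x0" "{}" 0] unfolding variance_term_def by simp
qed

text \<open>The case of coin 0. The old error is orthogonal to the worker noises, and these to each
  other, so averaging over workers reduces their mean variance by the factor
  \<open>1 / n\<close>.\<close>

lemma quantized_err_second_moment:
  "(\<integral>w. (norm (err k w + (1 / real n) *\<^sub>R (\<Sum>i=1..n. worker_noise k i w)))\<^sup>2 \<partial>M)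
    \<le> (\<integral>w. (norm (err k w))\<^sup>2 \<partial>M) + step_factor / real n * (\<integral>w. (norm (x (Suc k) w - x k w))\<^sup>2 \<partial>M)"
proof -
  let ?r = "\<integral>w. (norm (x (Suc k) w - x k w))\<^sup>2 \<partial>M"
  have "orthogonal_vars M (err k) (worker_noise k i)" if "i \<in> {1..n}" for i
    using that
    by (intro worker_noise_orthogonal[of _ _ "past k"] err_measurable sq_integrable_err)
      (auto simp: past_def)
  then have "orthogonal_vars M (err k) (\<lambda>w. (1 / real n) *\<^sub>R (\<Sum>i=1..n. worker_noise k i w))"
    by (intro orthogonal_vars_scaleR orthogonal_vars_sum sq_integrable_err)
  then have "(\<integral>w. (norm (err k w + (1 / real n) *\<^sub>R (\<Sum>i=1..n. worker_noise k i w)))\<^sup>2 \<partial>M)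
      = (\<integral>w. (norm (err k w))\<^sup>2 \<partial>M)
        + (\<integral>w. (norm ((1 / real n) *\<^sub>R (\<Sum>i=1..n. worker_noise k i w)))\<^sup>2 \<partial>M)"
    by (rule orthogonal_vars_norm_sq)
  also have "(\<integral>w. (norm ((1 / real n) *\<^sub>R (\<Sum>i=1..n. worker_noise k i w)))\<^sup>2 \<partial>M)
      = (1 / real n)\<^sup>2 * (\<integral>w. (norm (\<Sum>i=1..n. worker_noise k i w))\<^sup>2 \<partial>M)"
    by (simp add: power_mult_distrib power_divide)
  also have "(\<integral>w. (norm (\<Sum>i=1..n. worker_noise k i w))\<^sup>2 \<partial>M)
      = (\<Sum>i=1..n. \<integral>w. (norm (worker_noise k i w))\<^sup>2 \<partial>M)"
  proof (rule orthogonal_vars_sum_norm_sq)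
    fix i j assume ij: "i \<in> {1..n}" "j \<in> {1..n}" "i \<noteq> j"
    \<comment> \<open>All sources except those that worker \<open>j\<close> draws freshly in
      iteration \<open>k\<close>; they still determine the noise of worker \<open>i\<close>.\<close>
    let ?S = "srcs - ({Sample (Suc k) j l | l. True} \<union> {Seed k j})"
    have "worker_noise k i \<in> borel_measurable (info ?S)"
      using ij by (intro worker_noise_measurable) (auto simp: past_def)
    then show "orthogonal_vars M (worker_noise k i) (worker_noise k j)"
      using ij by (intro worker_noise_orthogonal[of _ _ ?S] sq_integrable_worker_noise) auto
  qed (auto intro: sq_integrable_worker_noise)
  also have "\<dots> \<le> (\<Sum>i=1..n. (\<omega> * (Ls i)\<^sup>2 + (1 + \<omega>) * (\<L>s i)\<^sup>2 / real b') * ?r)"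
    by (intro sum_mono worker_noise_second_moment)
  also have "\<dots> = real n * step_factor * ?r"
    unfolding step_factor_def using n by (simp add: sum_distrib_right)
  also have "(1 / real n)\<^sup>2 * (real n * step_factor * ?r) = step_factor / real n * ?r"
    using n by (simp add: power2_eq_square)
  finally show ?thesis
    by (simp add: mult_left_mono)
qed

lemma err_Suc:
  "(\<integral>w. (norm (err (Suc k) w))\<^sup>2 \<partial>M)
    \<le> p * variance_term + (1 - p) * ((\<integral>w. (norm (err k w))\<^sup>2 \<partial>M)
        + step_factor / real n * (\<integral>w. (norm (x (Suc k) w - x k w))\<^sup>2 \<partial>M))"
proof -
  let ?A = "\<lambda>w. (1 / (real n * real b)) *\<^sub>R (\<Sum>i=1..n. \<Sum>j\<in>I i (Suc k). noise (Suc k) i j (x (Suc k)) w)"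
  let ?B = "\<lambda>w. err k w + (1 / real n) *\<^sub>R (\<Sum>i=1..n. worker_noise k i w)"
  have past: "past k \<subseteq> srcs - {Sample (Suc k) i j | i j. True}"
    by (auto simp: past_def)
  note A = batch_noise_second_moment[OF x_Suc_measurable past]
  have B: "sq_integrable M ?B"
    by (intro sq_integrable_add sq_integrable_err sq_integrable_scaleR sq_integrable_sum
        sq_integrable_worker_noise)
  \<comment> \<open>For coin 1 the old error disappears. For coin 0 the mean of the
    \<open>grad_diff k i\<close> is the change of \<open>grad f\<close>, so subtracting it from the
    messages turns the old error into the new one.\<close>
  have err: "err (Suc k) w = (if c k w then ?A w else ?B w)" for w
  proof (cases "c k w")
    case True
    then show ?thesis
      using batch_noise_eq[of "Suc k" w "x (Suc k)"] unfolding err_def g_Suc gw_Suc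
      by (simp add: scaleR_sum_right)
  next
    case False
    have "(\<Sum>i=1..n. g k w) = real n *\<^sub>R g k w"
      by (simp add: sum_constant_scaleR del: sum_constant)
    then have g: "g (Suc k) w = g k w + (1 / real n) *\<^sub>R (\<Sum>i=1..n. Q (s k i w) (Dt k i w))"
      using False n unfolding g_Suc gw_Suc by (simp add: sum.distrib scaleR_add_right)
    show ?thesis
      using False unfolding err_def g worker_noise_eq grad_f
      by (simp add: grad_diff_def sum_subtractf scaleR_diff_right)
  qed
  have Am: "?A \<in> borel_measurable (info (srcs - {Coin k}))"
    by (intro borel_measurable_scaleR borel_measurable_const borel_measurable_sum noise_measurable
        iterate_measurable_info sample_measurable past_fresh) auto
  have Bm: "?B \<in> borel_measurable (info (srcs - {Coin k}))"
    by (intro borel_measurable_add borel_measurable_scaleR borel_measurable_const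
        borel_measurable_sum worker_noise_measurable err_measurable past_fresh) auto
  have "(\<integral>w. (norm (err (Suc k) w))\<^sup>2 \<partial>M)
      = p * (\<integral>w. (norm (?A w))\<^sup>2 \<partial>M) + (1 - p) * (\<integral>w. (norm (?B w))\<^sup>2 \<partial>M)"
    unfolding err by (rule coin_norm_sq[OF Am A(1) Bm B])
  also have "\<dots> \<le> p * variance_term + (1 - p) * ((\<integral>w. (norm (err k w))\<^sup>2 \<partial>M)
        + step_factor / real n * (\<integral>w. (norm (x (Suc k) w - x k w))\<^sup>2 \<partial>M))"
    using p A(2) quantized_err_second_moment unfolding variance_term_def
    by (intro add_mono mult_left_mono) auto
  finally show ?thesis .
qed

end

section \<open>Convergence\<close>

context vr_marina
begin

text \<open>Bounded below by the minimum and above by a quadratic, \<open>f\<close> is integrable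
  along square-integrable iterates.\<close>

lemma integrable_f:
  assumes xstar: "\<And>y. f xstar \<le> f y"
  shows "integrable M (\<lambda>w. f (x k w))"
proof (rule Bochner_Integration.integrable_bound)
  let ?B = "\<lambda>w. \<bar>f xstar\<bar> + \<bar>f 0\<bar> + \<bar>inner (grad f 0) (x k w)\<bar> + \<bar>L\<bar> / 2 * (norm (x k w))\<^sup>2"
  have "integrable M (\<lambda>w. inner (grad f 0) (x k w))"
    by (intro sq_integrable_inner sq_integrable_const sq_integrable_iterate)
  then show "integrable M ?B"
    using sq_integrable_iterate(1)[of k] unfolding sq_integrable_def by auto
  show "(\<lambda>w. f (x k w)) \<in> borel_measurable M"
    using measurable_compose[OF iterate_rv(1) f_measurable] .
  have "\<bar>f y\<bar> \<le> \<bar>f xstar\<bar> + \<bar>f 0\<bar> + \<bar>inner (grad f 0) y\<bar> + \<bar>L\<bar> / 2 * (norm y)\<^sup>2" for y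
  proof -
    have "f y \<le> f 0 + inner (grad f 0) y + L / 2 * (norm y)\<^sup>2"
      using smooth_with_upper_bound[OF smooth_f, of y 0] by simp
    moreover have "L / 2 * (norm y)\<^sup>2 \<le> \<bar>L\<bar> / 2 * (norm y)\<^sup>2"
      by (intro mult_right_mono) auto
    moreover have "0 \<le> \<bar>L\<bar> / 2 * (norm y)\<^sup>2"
      by simp
    ultimately show ?thesis
      using xstar[of y] by linarith
  qed
  then show "AE w in M. norm (f (x k w)) \<le> norm (?B w)"
    by (intro AE_I2) (auto intro: order_trans[OF _ abs_ge_self])
qed

text \<open>The Polyak-Lojasiewicz inequality trades the squared gradient of the descent inequality
  for the gap, pointwise in \<open>w\<close>; the result is integrated.\<close>

lemma expected_gap_Suc:
  assumes \<gamma>: "\<gamma> > 0" and pl: "polyak_lojasiewicz \<mu> f xstar"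
  shows "(\<integral>w. f (x (Suc k) w) - f xstar \<partial>M)
    \<le> (1 - \<gamma> * \<mu>) * (\<integral>w. f (x k w) - f xstar \<partial>M)
      - (1 / (2 * \<gamma>) - L / 2) * (\<integral>w. (norm (x (Suc k) w - x k w))\<^sup>2 \<partial>M)
      + \<gamma> / 2 * (\<integral>w. (norm (err k w))\<^sup>2 \<partial>M)"
proof -
  have xstar: "f xstar \<le> f y" for y
    using pl unfolding polyak_lojasiewicz_def is_arg_min_def by (meson not_le)
  have int: "integrable M (\<lambda>w. f (x k w) - f xstar)" for k
    using integrable_f[OF xstar] by auto
  have int_step: "integrable M (\<lambda>w. (norm (x (Suc k) w - x k w))\<^sup>2)"
    and int_err: "integrable M (\<lambda>w. (norm (err k w))\<^sup>2)"
    using sq_integrable_step sq_integrable_err unfolding sq_integrable_def by auto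
  have "f (x (Suc k) w) - f xstar \<le> (1 - \<gamma> * \<mu>) * (f (x k w) - f xstar)
      - (1 / (2 * \<gamma>) - L / 2) * (norm (x (Suc k) w - x k w))\<^sup>2 + \<gamma> / 2 * (norm (err k w))\<^sup>2" for w
  proof -
    have "2 * \<mu> * (f (x k w) - f xstar) \<le> (norm (grad f (x k w)))\<^sup>2"
      using pl unfolding polyak_lojasiewicz_def by blast
    then have "\<gamma> / 2 * (2 * \<mu> * (f (x k w) - f xstar)) \<le> \<gamma> / 2 * (norm (grad f (x k w)))\<^sup>2"
      using \<gamma> by (intro mult_left_mono) auto
    then show ?thesis
      using smooth_step_descent[OF smooth_f \<gamma> x_Suc, of k w] unfolding err_def
      by (simp add: algebra_simps)
  qed
  then have "(\<integral>w. f (x (Suc k) w) - f xstar \<partial>M)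
      \<le> (\<integral>w. (1 - \<gamma> * \<mu>) * (f (x k w) - f xstar)
      - (1 / (2 * \<gamma>) - L / 2) * (norm (x (Suc k) w - x k w))\<^sup>2 + \<gamma> / 2 * (norm (err k w))\<^sup>2 \<partial>M)"
    using int int_step int_err by (intro integral_mono) auto
  also have "\<dots> = (1 - \<gamma> * \<mu>) * (\<integral>w. f (x k w) - f xstar \<partial>M)
      - (1 / (2 * \<gamma>) - L / 2) * (\<integral>w. (norm (x (Suc k) w - x k w))\<^sup>2 \<partial>M)
      + \<gamma> / 2 * (\<integral>w. (norm (err k w))\<^sup>2 \<partial>M)"
    using int[of k] int_step int_err
    by (simp only: Bochner_Integration.integral_add Bochner_Integration.integral_diff
        integral_mult_right_zero integrable_mult_right Bochner_Integration.integrable_diff)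
  finally show ?thesis .
qed

lemma expected_lyapunov_bound:
  assumes \<gamma>: "\<gamma> > 0" and \<mu>: "\<mu> > 0" and pl: "polyak_lojasiewicz \<mu> f xstar"
    and \<gamma>\<mu>: "\<gamma> * \<mu> \<le> p / 2"
    and \<gamma>L: "\<gamma> * L + \<gamma>\<^sup>2 * (2 * (1 - p) / (p * real n) * step_factor) \<le> 1"
  shows "(\<integral>w. f (x K w) - f xstar \<partial>M) + \<gamma> / p * (\<integral>w. (norm (err K w))\<^sup>2 \<partial>M)
    \<le> (1 - \<gamma> * \<mu>) ^ K * (f x0 - f xstar) + variance_term / \<mu>"
proof (induction K)
  case 0
  have "\<gamma> / p \<le> 1 / \<mu>"
    using \<gamma>\<mu> p \<mu> by (simp add: field_simps)
  moreover have "variance_term \<ge> 0"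
    unfolding variance_term_def by (simp add: sum_nonneg)
  ultimately have "\<gamma> / p * (\<integral>w. (norm (err 0 w))\<^sup>2 \<partial>M) \<le> 1 / \<mu> * variance_term"
    using err_0 \<mu> by (intro mult_mono) auto
  then show ?case
    by (simp add: x_0 prob_space)
next
  case (Suc k)
  let ?E = "\<lambda>k. \<integral>w. f (x k w) - f xstar \<partial>M"
  let ?G = "\<lambda>k. \<integral>w. (norm (err k w))\<^sup>2 \<partial>M"
  let ?r = "\<integral>w. (norm (x (Suc k) w - x k w))\<^sup>2 \<partial>M"
  let ?S = "(1 - p) / (p * real n) * step_factor"
  have r: "?r \<ge> 0" and G: "?G k \<ge> 0"
    by simp_all
  have "\<gamma> / p * ?G (Suc k) \<le> \<gamma> / p * (p * variance_term + (1 - p) * (?G k + step_factor / real n * ?r))"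
    using \<gamma> p err_Suc by (intro mult_left_mono) auto
  also have "\<dots> = \<gamma> * variance_term + (\<gamma> / p - \<gamma>) * ?G k + \<gamma> * ?S * ?r"
    using p n by (simp add: field_simps)
  finally have 1: "\<gamma> / p * ?G (Suc k) \<le> \<gamma> * variance_term + (\<gamma> / p - \<gamma>) * ?G k + \<gamma> * ?S * ?r" .
  \<comment> \<open>The net coefficient of the squared step: growth of the weighted error minus the
    reserve from descent. Its sign is that of the quadratic condition on
    \<open>\<gamma>\<close>.\<close>
  have "\<gamma> * ?S - (1 / (2 * \<gamma>) - L / 2) = (\<gamma> * L + \<gamma>\<^sup>2 * (2 * ?S) - 1) / (2 * \<gamma>)"
    using \<gamma> by (simp add: field_simps power2_eq_square)
  also have "2 * ?S = 2 * (1 - p) / (p * real n) * step_factor"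
    by simp
  also have "(\<gamma> * L + \<gamma>\<^sup>2 * (2 * (1 - p) / (p * real n) * step_factor) - 1) / (2 * \<gamma>) \<le> 0"
    using \<gamma> \<gamma>L by (intro divide_nonpos_pos) (simp_all only: diff_le_0_iff_le mult_pos_pos zero_less_numeral)
  finally have 2: "(\<gamma> * ?S - (1 / (2 * \<gamma>) - L / 2)) * ?r \<le> 0"
    using r by (rule mult_nonpos_nonneg)
  \<comment> \<open>The weight \<open>\<gamma> / p\<close> loses \<open>\<gamma>\<close> through
    coin 1 and regains \<open>\<gamma> / 2\<close> from the descent inequality. The net loss
    suffices for the contraction since \<open>\<gamma> * \<mu> \<le> p / 2\<close>.\<close>
  have "\<gamma> / p - \<gamma> / 2 \<le> (1 - \<gamma> * \<mu>) * (\<gamma> / p)"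
    using mult_left_mono[OF \<gamma>\<mu>, of "\<gamma> / p"] \<gamma> p by (simp add: algebra_simps)
  from mult_right_mono[OF this G]
  have 3: "(\<gamma> / p - \<gamma> / 2) * ?G k \<le> (1 - \<gamma> * \<mu>) * (\<gamma> / p * ?G k)"
    by (simp add: mult.assoc)
  have "?E (Suc k) + \<gamma> / p * ?G (Suc k)
      \<le> (1 - \<gamma> * \<mu>) * ?E k + (\<gamma> * ?S - (1 / (2 * \<gamma>) - L / 2)) * ?r
        + (\<gamma> / p - \<gamma> / 2) * ?G k + \<gamma> * variance_term"
    using expected_gap_Suc[OF \<gamma> pl, of k] 1 by (simp add: algebra_simps)
  also have "\<dots> \<le> (1 - \<gamma> * \<mu>) * (?E k + \<gamma> / p * ?G k) + \<gamma> * variance_term"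
    using 2 3 by (simp add: distrib_left)
  also have "\<dots> \<le> (1 - \<gamma> * \<mu>) * ((1 - \<gamma> * \<mu>) ^ k * (f x0 - f xstar) + variance_term / \<mu>)
      + \<gamma> * variance_term"
    using \<gamma>\<mu> p by (intro add_right_mono mult_left_mono[OF Suc]) auto
  \<comment> \<open>\<open>variance_term / \<mu>\<close> is the fixed point of the map taking
    \<open>t\<close> to
    \<open>(1 - \<gamma> * \<mu>) * t + \<gamma> * variance_term\<close>.\<close>
  also have "\<dots> = (1 - \<gamma> * \<mu>) ^ Suc k * (f x0 - f xstar) + variance_term / \<mu>"
    using \<mu> by (simp add: field_simps)
  finally show ?case .
qed

lemma expected_gap_bound:
  assumes "\<gamma> > 0" "\<mu> > 0" "polyak_lojasiewicz \<mu> f xstar" "\<gamma> * \<mu> \<le> p / 2"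
    and "\<gamma> * L + \<gamma>\<^sup>2 * (2 * (1 - p) / (p * real n) * step_factor) \<le> 1"
  shows "(\<integral>w. f (x K w) - f xstar \<partial>M)
    \<le> (1 - \<gamma> * \<mu>) ^ K * (f x0 - f xstar) + variance_term / \<mu>"
proof -
  have "0 \<le> \<gamma> / p * (\<integral>w. (norm (err K w))\<^sup>2 \<partial>M)"
    using assms(1) p by simp
  with expected_lyapunov_bound[OF assms, of K] show ?thesis
    by linarith
qed

section \<open>Oracle calls and communication\<close>

lemma expected_coin_sum:
  fixes u v :: real and K :: nat
  shows "integrable M (\<lambda>w. \<Sum>k<K. if c k w then u else v)"
    and "(\<integral>w. (\<Sum>k<K. if c k w then u else v) \<partial>M) = real K * (p * u + (1 - p) * v)"
proof -
  have 1: "integrable M (\<lambda>w. if c k w then u else v)" for k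
    by (intro coin_integral(1)) auto
  have 2: "(\<integral>w. (if c k w then u else v) \<partial>M) = p * u + (1 - p) * v" for k
    by (subst coin_integral(2)) (auto simp: prob_space)
  show "integrable M (\<lambda>w. \<Sum>k<K. if c k w then u else v)"
    using 1 by (intro Bochner_Integration.integrable_sum)
  show "(\<integral>w. (\<Sum>k<K. if c k w then u else v) \<partial>M) = real K * (p * u + (1 - p) * v)"
    using 1 by (subst Bochner_Integration.integral_sum) (auto simp: 2)
qed

lemma expected_oracle_calls:
  fixes K :: nat
  assumes i: "i \<in> {1..n}"
  shows "(\<integral>w. real (oracle_calls I I' c i K w) \<partial>M)
    = real b + real K * (p * real b + 2 * (1 - p) * real b')"
proof -
  have "real (oracle_calls I I' c i K w) = real b + (\<Sum>k<K. if c k w then real b else 2 * real b')" for w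
    unfolding oracle_calls_def using batch_size i by (auto simp: intro!: sum.cong)
  then show ?thesis
    using expected_coin_sum[where K = K and u = "real b" and v = "2 * real b'"]
    by (simp add: prob_space algebra_simps)
qed

lemma expected_communication_cost:
  fixes d \<zeta> :: real and K :: nat
  shows "(\<integral>w. communication_cost d \<zeta> c K w \<partial>M) = d + real K * (p * d + (1 - p) * \<zeta>)"
  unfolding communication_cost_def using expected_coin_sum[where K = K and u = d and v = \<zeta>] by (simp add: prob_space)

section \<open>Expected number of non-zero components\<close>

lemma nnz_le: "real (nnz y) \<le> real CARD('d)" for y :: "real^'d"
  unfolding nnz_def by (simp add: card_mono)

lemma nnz_measurable [measurable]: "(\<lambda>y :: real^'d. real (nnz y)) \<in> borel_measurable borel"
proof -
  have "real (nnz y) = (\<Sum>j\<in>UNIV. if y $ j \<noteq> 0 then 1 else 0)" for y :: "real^'d"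
    unfolding nnz_def by (simp add: sum.If_cases)
  moreover have [measurable]: "(\<lambda>y :: real^'d. y $ j) \<in> borel_measurable borel" for j
    by (intro borel_measurable_continuous_onI continuous_intros)
  ultimately show ?thesis
    by simp
qed

lemma nnz_integrable:
  fixes y :: "_ \<Rightarrow> real^'d"
  assumes "prob_space N" "y \<in> borel_measurable N"
  shows "integrable N (\<lambda>w. real (nnz (y w)))" "(\<integral>w. real (nnz (y w)) \<partial>N) \<le> real CARD('d)"
proof -
  interpret N: prob_space N by fact
  note assms(2)[measurable]
  show int: "integrable N (\<lambda>w. real (nnz (y w)))"
    by (rule N.integrable_const_bound[of _ "real CARD('d)"]) (use nnz_le in auto)
  show "(\<integral>w. real (nnz (y w)) \<partial>N) \<le> real CARD('d)"
    using int nnz_le by (intro N.integral_le_const) auto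
qed

lemma Q_measurable_QM: "(\<lambda>v. Q v y) \<in> borel_measurable QM"
  using Q_integrable by (rule borel_measurable_integrable)

text \<open>The dimension bounds all the expectations, so the real-valued supremum is a genuine
  upper bound.\<close>

lemma expected_nnz_le_density: "(\<integral>v. real (nnz (Q v y)) \<partial>QM) \<le> expected_density QM Q"
  unfolding expected_density_def
  using nnz_integrable(2)[OF Q_prob Q_measurable_QM]
  by (intro cSUP_upper bdd_aboveI2) auto

lemma expected_density_nonneg: "expected_density QM Q \<ge> 0"
  using expected_nnz_le_density[of 0] by (rule order_trans[rotated]) simp

text \<open>The seed is independent of the difference to be quantized; freezing the latter reduces
  the claim to deterministic inputs.\<close>

lemma expected_nnz_quantized:
  assumes i: "i \<in> {1..n}"
  shows "(\<integral>w. real (nnz (Q (s k i w) (Dt k i w))) \<partial>M) \<le> expected_density QM Q"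
proof -
  note Q_swap_measurable[measurable]
  have y: "Dt k i \<in> borel_measurable (info (srcs - {Seed k i}))"
    using i by (rule Dt_measurable_others)
  then have DtM: "Dt k i \<in> borel_measurable M"
    by (rule measurable_info_imp) auto
  have int: "integrable M (\<lambda>w. real (nnz (Q (s k i w) (Dt k i w))))"
    by (intro nnz_integrable prob_space_axioms Q_measurable seed_rv i DtM)
  have "(\<integral>w. real (nnz (Q (s k i w) (Dt k i w))) \<partial>M)
      = (\<integral>w. \<integral>v. real (nnz (Q v (Dt k i w))) \<partial>distr M QM (s k i) \<partial>M)"
    using integral_frozen[OF subalgebra_info indep_seed y seed_rv[OF i],
        of "\<lambda>z. real (nnz (Q (snd z) (fst z)))"] i int
    by simp
  also have "\<dots> = (\<integral>w. \<integral>v. real (nnz (Q v (Dt k i w))) \<partial>QM \<partial>M)"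
    unfolding seed_law[OF i] ..
  also have "\<dots> \<le> expected_density QM Q"
  proof (rule integral_le_const)
    interpret QM: prob_space QM
      by (rule Q_prob)
    have "(\<lambda>y. \<integral>v. real (nnz (Q v y)) \<partial>QM) \<in> borel_measurable borel"
      by (rule QM.borel_measurable_lebesgue_integral) (simp add: split_beta')
    from measurable_compose[OF DtM this]
    show "integrable M (\<lambda>w. \<integral>v. real (nnz (Q v (Dt k i w))) \<partial>QM)"
      using expected_nnz_le_density
      by (intro integrable_const_bound[of _ "expected_density QM Q"]) auto
  qed (use expected_nnz_le_density in simp)
  finally show ?thesis .
qed

text \<open>The coin is independent of both candidate messages, so their expected sizes mix with
  weights \<open>p\<close> and \<open>1 - p\<close>; the first is bounded by the dimension, the
  second by the expected density.\<close>

lemma expected_sent_components: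
  assumes i: "i \<in> {1..n}"
  shows "integrable M (\<lambda>w. real (sent_components Q c s gw Dt i K w))"
    and "(\<integral>w. real (sent_components Q c s gw Dt i K w) \<partial>M)
      \<le> real CARD('d) + real K * (p * real CARD('d) + (1 - p) * expected_density QM Q)"
proof -
  let ?A = "\<lambda>k w. (1 / real b) *\<^sub>R (\<Sum>j\<in>I i (Suc k). grad (F (xi (Suc k) i j w)) (x (Suc k) w))"
  let ?B = "\<lambda>k w. Q (s k i w) (Dt k i w)"
  have eq: "real (sent_components Q c s gw Dt i K w)
      = real (nnz (gw 0 i w)) + (\<Sum>k<K. if c k w then real (nnz (?A k w)) else real (nnz (?B k w)))" for w
    unfolding sent_components_def gw_Suc by (auto intro!: sum.cong)
  have "gw 0 i \<in> borel_measurable M"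
    unfolding gw_0
    by (intro borel_measurable_scaleR borel_measurable_const borel_measurable_sum
        sample_grad_measurable sample_rv i)
  note g0 = nnz_integrable[OF prob_space_axioms this]
  have Am: "?A k \<in> borel_measurable (info (srcs - {Coin k}))" for k
    using i
    by (intro borel_measurable_scaleR borel_measurable_const borel_measurable_sum
        sample_grad_measurable iterate_measurable_info sample_measurable past_fresh) auto
  have Bm: "?B k \<in> borel_measurable (info (srcs - {Coin k}))" for k
    using i by (intro Q_measurable seed_measurable Dt_measurable_others) auto
  note A = nnz_integrable[OF prob_space_axioms measurable_info_imp[OF Am Diff_subset]]
  note B = nnz_integrable(1)[OF prob_space_axioms measurable_info_imp[OF Bm Diff_subset]]
  note coin = coin_integral[OF measurable_compose[OF Am nnz_measurable] A(1)
      measurable_compose[OF Bm nnz_measurable] B]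
  show "integrable M (\<lambda>w. real (sent_components Q c s gw Dt i K w))"
    unfolding eq using g0(1) coin(1) by (intro Bochner_Integration.integrable_add Bochner_Integration.integrable_sum)
  have "(\<integral>w. real (sent_components Q c s gw Dt i K w) \<partial>M)
      = (\<integral>w. real (nnz (gw 0 i w)) \<partial>M)
        + (\<Sum>k<K. p * (\<integral>w. real (nnz (?A k w)) \<partial>M) + (1 - p) * (\<integral>w. real (nnz (?B k w)) \<partial>M))"
    unfolding eq using g0(1) coin
    by (simp only: Bochner_Integration.integral_add Bochner_Integration.integral_sum
        Bochner_Integration.integrable_sum)
  also have "\<dots> \<le> real CARD('d) + (\<Sum>k<K. p * real CARD('d) + (1 - p) * expected_density QM Q)"
    using g0(2) A(2) p expected_nnz_quantized[OF i] by (intro add_mono sum_mono mult_left_mono) auto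
  finally show "(\<integral>w. real (sent_components Q c s gw Dt i K w) \<partial>M)
      \<le> real CARD('d) + real K * (p * real CARD('d) + (1 - p) * expected_density QM Q)"
    by simp
qed

end

section \<open>Iteration complexity\<close>

text \<open>Both summands of \<open>\<gamma> * L + \<gamma> * sqrt B \<le> 1\<close> are
  nonnegative, so the second is at most 1 and dominates its square.\<close>

lemma stepsize_bound:
  fixes \<gamma> L B :: real
  assumes "\<gamma> > 0" "L \<ge> 0" "B \<ge> 0" "\<gamma> \<le> 1 / (L + sqrt B)"
  shows "\<gamma> * L + \<gamma>\<^sup>2 * B \<le> 1"
proof -
  \<comment> \<open>Otherwise the right-hand side of the stepsize bound would be
    \<open>1 / 0 = 0\<close>, against \<open>\<gamma> > 0\<close>.\<close>
  have "L + sqrt B > 0"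
    using assms by (smt (verit) div_by_0 real_sqrt_ge_zero)
  then have 1: "\<gamma> * (L + sqrt B) \<le> 1"
    using assms(4) by (simp add: field_simps)
  moreover have "\<gamma> * L \<ge> 0" "\<gamma> * sqrt B \<ge> 0"
    using assms by auto
  ultimately have "\<gamma> * sqrt B \<le> 1"
    by (simp add: distrib_left)
  then have "(\<gamma> * sqrt B)\<^sup>2 \<le> \<gamma> * sqrt B"
    using \<open>\<gamma> * sqrt B \<ge> 0\<close> by (simp add: power2_eq_square mult_left_le)
  then show ?thesis
    using 1 assms(3) by (simp add: power_mult_distrib distrib_left)
qed

text \<open>Each branch of the minimum costs at most a factor 2: the second exactly, the first
  because \<open>sqrt 2 \<le> 2\<close>.\<close>

lemma inverse_stepsize_bound:
  fixes \<gamma> \<mu> L S p :: real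
  assumes "\<gamma> > 0" "\<mu> > 0" "p > 0" "L \<ge> 0" "S \<ge> 0"
    and \<gamma>: "\<gamma> = min (1 / (L + sqrt (2 * S))) (p / (2 * \<mu>))"
  shows "1 / (\<gamma> * \<mu>) \<le> 2 * max (1 / p) ((L + sqrt S) / \<mu>)"
proof (cases "\<gamma> = p / (2 * \<mu>)")
  case True
  then have "1 / (\<gamma> * \<mu>) = 2 * (1 / p)"
    using assms by simp
  then show ?thesis
    by (simp only: max.cobounded1 mult_left_mono)
next
  case False
  then have "\<gamma> = 1 / (L + sqrt (2 * S))"
    using \<gamma> by linarith
  then have "1 / (\<gamma> * \<mu>) = (L + sqrt (2 * S)) / \<mu>"
    by simp
  also have "\<dots> \<le> (2 * (L + sqrt S)) / \<mu>"
  proof (rule divide_right_mono)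
    have "sqrt 2 * sqrt S \<le> 2 * sqrt S"
      using assms by (intro mult_right_mono real_le_lsqrt) auto
    then show "L + sqrt (2 * S) \<le> 2 * (L + sqrt S)"
      using assms by (simp add: real_sqrt_mult)
  qed (use assms in auto)
  also have "\<dots> = 2 * ((L + sqrt S) / \<mu>)"
    by simp
  also have "\<dots> \<le> 2 * max (1 / p) ((L + sqrt S) / \<mu>)"
    by (intro mult_left_mono) auto
  finally show ?thesis .
qed

lemma geometric_decay_iterations:
  fixes q \<Delta> \<epsilon> R :: real
  assumes q: "0 < q" "q \<le> 1" and \<epsilon>: "\<epsilon> > 0" and \<Delta>: "\<Delta> \<ge> 0" and R: "1 / q \<le> 2 * R" "R \<ge> 1"
  shows "\<exists>K::nat. real K \<le> 5 * (R * max 1 (ln (\<Delta> / \<epsilon>))) \<and> (1 - q) ^ K * \<Delta> \<le> \<epsilon> / 2"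
proof -
  define l where "l = max 1 (ln (\<Delta> / \<epsilon>))"
  \<comment> \<open>Then \<open>q * real K\<close> is at least \<open>2 * l\<close>, hence at least
    \<open>1 + ln (\<Delta> / \<epsilon>)\<close>, and the extra 1 yields the factor
    \<open>exp (- 1) \<le> 1 / 2\<close>. Of the constant 5, four units come from
    \<open>2 * l * (2 * R)\<close> and one from rounding up.\<close>
  define K where "K = nat \<lceil>2 * l * (1 / q)\<rceil>"
  have l: "l \<ge> 1" "ln (\<Delta> / \<epsilon>) \<le> l"
    unfolding l_def by auto
  have K: "2 * l * (1 / q) \<le> real K" "real K \<le> 2 * l * (1 / q) + 1"
  proof -
    have "0 \<le> 2 * l * (1 / q)"
      using l q by simp
    then show "2 * l * (1 / q) \<le> real K" "real K \<le> 2 * l * (1 / q) + 1"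
      unfolding K_def by linarith+
  qed
  have "2 * l * (1 / q) \<le> 2 * l * (2 * R)"
    using l R by (intro mult_left_mono) auto
  moreover have "1 \<le> R * l"
    using l R mult_mono[of 1 R 1 l] by simp
  ultimately have "real K \<le> 5 * (R * l)"
    using K(2) by (simp add: algebra_simps)
  moreover have "(1 - q) ^ K * \<Delta> \<le> \<epsilon> / 2"
  proof (cases "\<Delta> = 0")
    case True
    then show ?thesis
      using \<epsilon> by simp
  next
    case False
    have "(1 - q) ^ K \<le> exp (- q) ^ K"
      using q exp_ge_add_one_self[of "- q"] by (intro power_mono) auto
    also have "\<dots> = exp (- (q * real K))"
      by (simp add: exp_of_nat_mult[symmetric] mult.commute)
    also have "\<dots> \<le> exp (- 1 - ln (\<Delta> / \<epsilon>))"
      using K(1) l q by (simp add: field_simps)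
    also have "\<dots> = exp (- 1) * (\<epsilon> / \<Delta>)"
      using False \<Delta> \<epsilon> by (simp add: exp_diff)
    also have "\<dots> \<le> 1 / 2 * (\<epsilon> / \<Delta>)"
      using exp_ge_add_one_self[of 1] \<Delta> \<epsilon>
      by (intro mult_right_mono) (auto simp: exp_minus field_simps)
    finally have "(1 - q) ^ K * \<Delta> \<le> 1 / 2 * (\<epsilon> / \<Delta>) * \<Delta>"
      using \<Delta> by (rule mult_right_mono)
    then show ?thesis
      using False by simp
  qed
  ultimately show ?thesis
    unfolding l_def by blast
qed

theorem theoremD4:
  fixes M :: "'w measure"
    and D :: "nat \<Rightarrow> 'xi measure"
    and F :: "'xi \<Rightarrow> real^'d \<Rightarrow> real"
    and QM :: "'q measure"
    and Q :: "'q \<Rightarrow> real^'d \<Rightarrow> real^'d"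
    and n b b' :: nat
    and p \<gamma> \<mu> \<omega> \<zeta> fstar L \<L> \<sigma> \<Delta>0 d R :: real
    and Ls \<L>s \<sigma>s :: "nat \<Rightarrow> real"
    and fi :: "nat \<Rightarrow> real^'d \<Rightarrow> real"
    and f :: "real^'d \<Rightarrow> real"
    and x0 xstar :: "real^'d"
    and I I' :: "nat \<Rightarrow> nat \<Rightarrow> nat set"
    and xi :: "nat \<Rightarrow> nat \<Rightarrow> nat \<Rightarrow> 'w \<Rightarrow> 'xi"
    and c :: "nat \<Rightarrow> 'w \<Rightarrow> bool"
    and s :: "nat \<Rightarrow> nat \<Rightarrow> 'w \<Rightarrow> 'q"
    and x g :: "nat \<Rightarrow> 'w \<Rightarrow> real^'d"
    and gw Dt :: "nat \<Rightarrow> nat \<Rightarrow> 'w \<Rightarrow> real^'d"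
  assumes "prob_space M"
    and n: "n \<ge> 1" and b: "1 \<le> b'" "b' < b" and p: "0 < p" "p \<le> 1" and mu: "\<mu> > 0"
    and losses: "stochastic_losses D F n"
    and fi: "fi = local_loss D F" and f: "f = global_loss D F n"
    and lower_bound: "\<And>y. f y \<ge> fstar"
    and smooth: "\<And>i. i \<in> {1..n} \<Longrightarrow> smooth_with (Ls i) (fi i)"
    and pl: "polyak_lojasiewicz \<mu> f xstar"
    and variance: "\<And>i. i \<in> {1..n} \<Longrightarrow> bounded_variance (D i) F (fi i) (\<sigma>s i)"
    and quant: "quantization QM Q \<omega>" and zeta: "\<zeta> = expected_density QM Q"
    and batches: "\<And>i t. i \<in> {1..n} \<Longrightarrow> card (I i t) = b \<and> card (I' i t) = b'"
    and sources: "independent_sources M D QM p n xi c s"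
    and run: "vr_marina_online F Q n b b' \<gamma> x0 I I' xi c s x g gw Dt"
    and avg: "\<And>i. i \<in> {1..n} \<Longrightarrow> average_smooth M x (fi i) (\<lambda>k. Dt k i) b' (\<L>s i)"
    and L: "L = sqrt ((1 / real n) * (\<Sum>i=1..n. (Ls i)\<^sup>2))"
    and calL: "\<L> = sqrt ((1 / real n) * (\<Sum>i=1..n. (\<L>s i)\<^sup>2))"
    and sigma: "\<sigma> = sqrt ((1 / real n) * (\<Sum>i=1..n. (\<sigma>s i)\<^sup>2))"
    and Delta0: "\<Delta>0 = f x0 - f xstar"
    and d: "d = real CARD('d)"
    and gamma_pos: "\<gamma> > 0"
    and gamma: "\<gamma> \<le> min (1 / (L + sqrt (2 * (1 - p) / (p * real n) *
                              (\<omega> * L\<^sup>2 + (1 + \<omega>) * \<L>\<^sup>2 / real b')))) (p / (2 * \<mu>))"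
    and R: "R = max (1 / p) ((L + sqrt ((1 - p) / (p * real n) *
                              (\<omega> * L\<^sup>2 + (1 + \<omega>) * \<L>\<^sup>2 / real b'))) / \<mu>)"
  shows
    \<comment> \<open>the guarantees after \<open>K\<close> iterations, for every \<open>K\<close>\<close>
    "(\<forall>K. integrable M (\<lambda>w. f (x K w) - f xstar) \<and>
          (\<integral>w. f (x K w) - f xstar \<partial>M) \<le> (1 - \<gamma> * \<mu>) ^ K * \<Delta>0 + \<sigma>\<^sup>2 / (real n * real b * \<mu>) \<and>
          (\<forall>i\<in>{1..n}.
             (\<integral>w. real (oracle_calls I I' c i K w) \<partial>M)
               = real b + real K * (p * real b + 2 * (1 - p) * real b') \<and>
             (\<integral>w. communication_cost d \<zeta> c K w \<partial>M) = d + real K * (p * d + (1 - p) * \<zeta>) \<and>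
             integrable M (\<lambda>w. real (sent_components Q c s gw Dt i K w)) \<and>
             (\<integral>w. real (sent_components Q c s gw Dt i K w) \<partial>M)
               \<le> d + real K * (p * d + (1 - p) * \<zeta>)))
     \<and>
     \<comment> \<open>the complexities for the largest admissible stepsize and \<open>b = \<Theta>(\<sigma>\<^sup>2 / (n \<mu> \<epsilon>))\<close>. The
        constants hidden in \<open>O\<close> are absolute, hence explicit numerals: an existential here could
        depend on the type \<open>'d\<close>, that is, on the dimension. As \<open>K\<close> and \<open>b\<close> are integers,
        the logarithm and the upper bound on \<open>b\<close> are cut off at 1.\<close>
     (\<forall>\<epsilon> > 0. \<forall>c\<^sub>b :: real.
        \<gamma> = min (1 / (L + sqrt (2 * (1 - p) / (p * real n) *
                              (\<omega> * L\<^sup>2 + (1 + \<omega>) * \<L>\<^sup>2 / real b')))) (p / (2 * \<mu>)) \<longrightarrow>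
        2 * (\<sigma>\<^sup>2 / (real n * \<mu> * \<epsilon>)) \<le> real b \<longrightarrow>
        real b \<le> c\<^sub>b * max 1 (\<sigma>\<^sup>2 / (real n * \<mu> * \<epsilon>)) \<longrightarrow>
        (\<exists>K::nat.
           real K \<le> 5 * (R * max 1 (ln (\<Delta>0 / \<epsilon>))) \<and>
           (\<integral>w. f (x K w) - f xstar \<partial>M) \<le> \<epsilon> \<and>
           real b + real K * (p * real b + 2 * (1 - p) * real b')
             \<le> 10 * (real b + R * (p * real b + (1 - p) * real b') * max 1 (ln (\<Delta>0 / \<epsilon>))) \<and>
           d + real K * (p * d + (1 - p) * \<zeta>)
             \<le> 5 * (d + R * (p * d + (1 - p) * \<zeta>) * max 1 (ln (\<Delta>0 / \<epsilon>)))))"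
proof -
  interpret prob_space M by fact
  interpret vr_marina M D F QM Q n b b' p \<gamma> \<omega> Ls \<L>s \<sigma>s x0 I I' xi c s x g gw Dt
    using n b p losses smooth variance quant batches sources run avg unfolding fi
    by unfold_locales auto
  have xstar: "f xstar \<le> f y" for y
    using pl unfolding polyak_lojasiewicz_def is_arg_min_def by (meson not_le)
  \<comment> \<open>\<open>local.L\<close> is the constant defined in the locale, as opposed to the
    variable \<open>L\<close> of the theorem.\<close>
  have L_eq: "local.L = L"
    unfolding L_def L ..
  have sum_Ls: "(1 / real n) * (\<Sum>i=1..n. (Ls i)\<^sup>2) = L\<^sup>2"
    and sum_\<L>s: "(1 / real n) * (\<Sum>i=1..n. (\<L>s i)\<^sup>2) = \<L>\<^sup>2"
    and sum_\<sigma>s: "(1 / real n) * (\<Sum>i=1..n. (\<sigma>s i)\<^sup>2) = \<sigma>\<^sup>2"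
    unfolding L calL sigma by (simp_all add: sum_nonneg)
  have L0: "L \<ge> 0"
    unfolding L by (simp add: sum_nonneg)
  \<comment> \<open>The quantity under the root in \<open>R\<close>; the stepsize contains twice
    this value.\<close>
  define S where "S = (1 - p) / (p * real n) * (\<omega> * L\<^sup>2 + (1 + \<omega>) * \<L>\<^sup>2 / real b')"
  have S0: "S \<ge> 0"
    unfolding S_def using p omega_pos by simp
  have S2: "2 * (1 - p) / (p * real n) * (\<omega> * L\<^sup>2 + (1 + \<omega>) * \<L>\<^sup>2 / real b') = 2 * S"
    unfolding S_def by simp
  have "step_factor = \<omega> * ((1 / real n) * (\<Sum>i=1..n. (Ls i)\<^sup>2))
      + (1 + \<omega>) * ((1 / real n) * (\<Sum>i=1..n. (\<L>s i)\<^sup>2)) / real b'"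
    unfolding step_factor_def
    by (simp add: sum.distrib sum_distrib_left[symmetric] sum_divide_distrib[symmetric] add_divide_distrib)
  then have step_factor: "2 * (1 - p) / (p * real n) * step_factor = 2 * S"
    unfolding sum_Ls sum_\<L>s S_def by simp
  have variance_term: "variance_term / \<mu> = \<sigma>\<^sup>2 / (real n * real b * \<mu>)"
    unfolding variance_term_def sum_\<sigma>s by simp
  have "\<gamma> * L + \<gamma>\<^sup>2 * (2 * S) \<le> 1"
    using gamma S0 unfolding S2 by (intro stepsize_bound gamma_pos L0) auto
  then have \<gamma>L: "\<gamma> * local.L + \<gamma>\<^sup>2 * (2 * (1 - p) / (p * real n) * step_factor) \<le> 1"
    unfolding step_factor L_eq .
  have "\<gamma> \<le> p / (2 * \<mu>)"
    using gamma by simp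
  then have \<gamma>\<mu>: "\<gamma> * \<mu> \<le> p / 2"
    using mu by (simp add: field_simps)
  have gap: "(\<integral>w. f (x K w) - f xstar \<partial>M)
      \<le> (1 - \<gamma> * \<mu>) ^ K * \<Delta>0 + \<sigma>\<^sup>2 / (real n * real b * \<mu>)" for K
    using expected_gap_bound[OF gamma_pos mu pl[unfolded f] \<gamma>\<mu> \<gamma>L, of K]
    unfolding f variance_term Delta0 .
  have \<zeta>0: "\<zeta> \<ge> 0"
    unfolding zeta by (rule expected_density_nonneg)
  have first: "integrable M (\<lambda>w. f (x K w) - f xstar)" for K
    using integrable_f[OF xstar[unfolded f], of K] unfolding f by simp
  have second: "\<exists>K::nat.
           real K \<le> 5 * (R * max 1 (ln (\<Delta>0 / \<epsilon>))) \<and>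
           (\<integral>w. f (x K w) - f xstar \<partial>M) \<le> \<epsilon> \<and>
           real b + real K * (p * real b + 2 * (1 - p) * real b')
             \<le> 10 * (real b + R * (p * real b + (1 - p) * real b') * max 1 (ln (\<Delta>0 / \<epsilon>))) \<and>
           d + real K * (p * d + (1 - p) * \<zeta>)
             \<le> 5 * (d + R * (p * d + (1 - p) * \<zeta>) * max 1 (ln (\<Delta>0 / \<epsilon>)))"
    if \<epsilon>: "\<epsilon> > 0" and \<gamma>: "\<gamma> = min (1 / (L + sqrt (2 * S))) (p / (2 * \<mu>))"
      and b_large: "2 * (\<sigma>\<^sup>2 / (real n * \<mu> * \<epsilon>)) \<le> real b" for \<epsilon>
  proof -
    let ?l = "max 1 (ln (\<Delta>0 / \<epsilon>))"
    have R_eq: "R = max (1 / p) ((L + sqrt S) / \<mu>)"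
      unfolding R S_def ..
    have R1: "R \<ge> 1"
      unfolding R_eq using p by (simp add: le_max_iff_disj)
    have "1 / (\<gamma> * \<mu>) \<le> 2 * R"
      unfolding R_eq using gamma_pos mu p(1) L0 S0 \<gamma> by (rule inverse_stepsize_bound)
    moreover have "0 < \<gamma> * \<mu>" "\<gamma> * \<mu> \<le> 1"
      using gamma_pos mu \<gamma>\<mu> p by auto
    ultimately obtain K :: nat where K: "real K \<le> 5 * (R * ?l)"
      and decay: "(1 - \<gamma> * \<mu>) ^ K * \<Delta>0 \<le> \<epsilon> / 2"
      using geometric_decay_iterations[of "\<gamma> * \<mu>" \<epsilon> \<Delta>0 R] R1 \<epsilon> xstar[of x0] unfolding Delta0 by auto
    \<comment> \<open>The batch size leaves half of \<open>\<epsilon>\<close> to the variance; the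
      decay of the initial gap takes the other half.\<close>
    have "\<sigma>\<^sup>2 / (real n * real b * \<mu>) \<le> \<epsilon> / 2"
      using b_large n b mu \<epsilon> by (simp add: field_simps)
    then have "(\<integral>w. f (x K w) - f xstar \<partial>M) \<le> \<epsilon>"
      using gap[of K] decay by linarith
    moreover have "real b + real K * (p * real b + 2 * (1 - p) * real b')
        \<le> 10 * (real b + R * (p * real b + (1 - p) * real b') * ?l)"
    proof -
      have "p * real b \<ge> 0" "(1 - p) * real b' \<ge> 0"
        using p by auto
      \<comment> \<open>A coin 0 costs two gradients per sample, which doubles the constant 5 to
        10.\<close>
      then have "real K * (p * real b + 2 * (1 - p) * real b')
          \<le> 5 * (R * ?l) * (2 * (p * real b + (1 - p) * real b'))"
        using K by (intro mult_mono) (auto simp: algebra_simps)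
      then show ?thesis
        by (simp add: algebra_simps)
    qed
    moreover have "d + real K * (p * d + (1 - p) * \<zeta>) \<le> 5 * (d + R * (p * d + (1 - p) * \<zeta>) * ?l)"
    proof -
      have "real K * (p * d + (1 - p) * \<zeta>) \<le> 5 * (R * ?l) * (p * d + (1 - p) * \<zeta>)"
        using p \<zeta>0 K unfolding d by (intro mult_right_mono) auto
      moreover have "d \<ge> 0"
        unfolding d by simp
      ultimately show ?thesis
        by (simp add: algebra_simps)
    qed
    ultimately show ?thesis
      using K by blast
  qed
  show ?thesis
    unfolding S2
    by (intro conjI allI impI ballI first gap second expected_oracle_calls
        expected_communication_cost expected_sent_components[folded d zeta])
qed

end
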